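(* Let $K^0$ be either one of the two compact open subgroups $K^0_{\mathrm{st}}$ or $K^0_{\mathrm{par}}$ of $G^0(F)$ defined in the context, with the associated $K_{M^0}$, $\rho_{M^0}$, $N(\rho_{M^0})$ and $W(\rho_{M^0})=N(\rho_{M^0})/K_{M^0}$. Let $\Omega(\rho_{M^0})=\{w\in W(\rho_{M^0}) : \ell_{\mathcal K\text{-rel}}(w)=0\}$. Then $$W(\rho_{M^0})=\Omega(\rho_{M^0}).$$ That is, every element of $W(\rho_{M^0})$ has length zero with respect to $\ell_{\mathcal K\text{-rel}}$.
   Context: Let $F$ be a non-archimedean local field with residue field $\mathfrak f$ of odd characteristic $p$ and order $q$, with $4\mid q-1$. For a finite extension $E/F$, $\mathcal O_E$, $\mathfrak p_E$, $N_{E/F}$ denote the ring of integers, its maximal ideal and the norm map. Fix a uniformizer $\varpi_F$ of $F$, a primitive $(q-1)$-st root of unity $\zeta\in F$, and a square root $\sqrt{-1}\in\mathbb C^\times$ of $-1$. Let $\eta\colon F^\times\to\mathbb C^\times$ be the unique character trivial on $\varpi_F$ and on $1+\mathfrak p_F$ with $\eta(\zeta)=\sqrt{-1}$. Let $E_2$ (resp. $E_4$) be the splitting field over $F$ of $X^2+\varpi_F$ (resp. $X^4+\zeta\varpi_F$); these are totally ramified of degree $2$ and $4$, so their residue fields are identified with $\mathfrak f$. Let $G^0$ be the group over $F$ given by $(\mathrm{Res}_{E_2/F}\mathrm{GL}_2\times\mathrm{Res}_{E_4/F}\mathrm{GL}_1)\cap\mathrm{SL}_8$ (embedded in $\mathrm{GL}_8$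 via $F$-bases of $E_2$ and $E_4$), so $G^0(F)=\{(g_2,g_4)\in\mathrm{GL}_2(E_2)\times E_4^\times: N_{E_2/F}(\det g_2)N_{E_4/F}(g_4)=1\}$. Let $M^0\subset G^0$ be the maximal torus for which $g_2$ is diagonal; write its $F$-points as $(x,y,z)\in E_2^\times\times E_2^\times\times E_4^\times$, meaning $(\mathrm{diag}(x,y),z)$. Let $I_2=\{\begin{pmatrix}a&b\\c&d\end{pmatrix}\in\mathrm{GL}_2(E_2): a,d\in\mathcal O_{E_2}^\times,\ b\in\mathcal O_{E_2},\ c\in\mathfrak p_{E_2}\}$. Put $K^0_{\mathrm{st}}=(I_2\times\mathcal O_{E_4}^\times)\cap G^0(F)$ (the stabilizer of a point $x_0$ of the enlarged Bruhat–Tits building) and $K^0_{\mathrm{par}}=\{(g_2,g_4)\in K^0_{\mathrm{st}}: (\det g_2\bmod\mathfrak p_{E_2})\cdot(g_4\bmod\mathfrak p_{E_4})^2=1 \text{ in }\mathfrak f^\times\}$ (the corresponding parahoric subgroup). For $K^0$ one of these, $K_{M^0}=K^0\cap M^0(F)$, and $\rho_{M^0}$ is the character $(x,y,z)\mapsto\eta(N_{E_2/F}(y))$ of $K_{M^0}$. Notation: ${}^nK=nKn^{-1}$ and ${}^n\rho(x)=\rho(n^{-1}xn)$. Put $N(\rho_{M^0})=\{n\in N_{G^0}(M^0)(F): {}^nK_{M^0}=K_{M^0},\ {}^n\rho_{M^0}=\rho_{M^0}\}$, where $N_{G^0}(M^0)$ is the normalizer, and $W(\rho_{M^0})=N(\rho_{M^0})/K_{M^0}$.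 Definition of $\ell_{\mathcal K\text{-rel}}$ (written out for this group). The chambers of the apartment of $M^0$ are indexed by $i\in\mathbb Z$. To chamber $i$ attach $K_{i,+}=\{(\begin{pmatrix}a&b\\c&d\end{pmatrix},g_4)\in G^0(F): a,d\in1+\mathfrak p_{E_2},\ b\in\mathfrak p_{E_2}^{-i},\ c\in\mathfrak p_{E_2}^{i+1},\ g_4\in1+\mathfrak p_{E_4}\}$, the group $K_i=K_{M^0}K_{i,+}$, and the character $\rho_i$ of $K_i$ that is trivial on $K_{i,+}$ and equals $\rho_{M^0}$ on $K_{M^0}$ (so $K_0=K^0$, and $x_0$ lies in chamber $0$). The walls are $H_i$ ($i\in\mathbb Z$), where $H_i$ is the wall separating the adjacent chambers $i$ and $i+1$. Let $\mathrm{ind}_{K_i}^{G^0(F)}(\rho_i)$ be the space of compactly supported functions $f\colon G^0(F)\to\mathbb C$ with $f(kg)=\rho_i(k)f(g)$ for $k\in K_i$. For $i,j\in\mathbb Z$ define $\Theta_{j|i}\colon\mathrm{ind}_{K_i}^{G^0(F)}(\rho_i)\to\mathrm{ind}_{K_j}^{G^0(F)}(\rho_j)$ by $(\Theta_{j|i}f)(g)=\int_{K_{j,+}}f(kg)\,dk$ (for any fixed Haar measure). The wall $H_i$ is called $\mathcal K$-relevant if $\Theta_{i|i+1}\circ\Theta_{i+1|i}\notin\mathbb C\cdot\mathrm{id}$ or $\Theta_{i+1|i}\circ\Theta_{i|i+1}\notin\mathbb C\cdot\mathrm{id}$. The group $N_{G^0}(M^0)(F)$ permutes the chambers via conjugation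 on the subgroups $K_{i,+}$: $n\cdot i=j$ if $nK_{i,+}n^{-1}=K_{j,+}$; $K_{M^0}$ acts trivially, so $W(\rho_{M^0})$ acts. For $w\in W(\rho_{M^0})$, $\ell_{\mathcal K\text{-rel}}(w)$ is the number of $\mathcal K$-relevant walls separating chamber $0$ from chamber $w\cdot 0$. *)

theory Defs
  imports
    "HOL-Analysis.Analysis"
    "HOL-Algebra.QuotRing"
    "HOL-Algebra.Algebraic_Closure_Type"
begin

text \<open>The value \<open>v 0\<close> is irrelevant: it stands for infinity.\<close>

locale discretely_valued_field =
  fixes v :: "'f::field \<Rightarrow> int"
  assumes v_mult: "x \<noteq> 0 \<Longrightarrow> y \<noteq> 0 \<Longrightarrow> v (x * y) = v x + v y"
    and v_add: "x \<noteq> 0 \<Longrightarrow> y \<noteq> 0 \<Longrightarrow> x + y \<noteq> 0 \<Longrightarrow> min (v x) (v y) \<le> v (x + y)"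
    and v_normalised: "\<exists>x. x \<noteq> 0 \<and> v x = 1"
begin

definition O_F :: "'f set" where "O_F = {x. x = 0 \<or> 0 \<le> v x}"

definition p_F :: "'f set" where "p_F = {x. x = 0 \<or> 1 \<le> v x}"

definition res_field :: "'f set ring" where
  "res_field = \<lparr>carrier = O_F, mult = (*), one = 1, zero = 0, add = (+)\<rparr> Quot p_F"

definition q_F :: nat where "q_F = card (carrier res_field)"

end

locale nonarch_local_field = discretely_valued_field v
  for v :: "'f::field \<Rightarrow> int" +
  assumes v_complete: "\<And>s :: nat \<Rightarrow> 'f.
        (\<forall>N. \<exists>M. \<forall>m\<ge>M. \<forall>n\<ge>M. s m = s n \<or> N \<le> v (s m - s n)) \<Longrightarrow>
        (\<exists>l. \<forall>N. \<exists>M. \<forall>n\<ge>M. s n = l \<or> N \<le> v (s n - l))"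
    and finite_residue_field: "finite (carrier res_field)"

text \<open>A finite extension \<open>\<iota> : F \<rightarrow> E\<close> of a local field, with an \<open>F\<close>-basis \<open>b\<close> of \<open>E\<close>.\<close>

locale local_field_ext = nonarch_local_field v
  for v :: "'f::field \<Rightarrow> int" +
  fixes \<iota> :: "'f \<Rightarrow> 'e::field" and b :: "'n::finite \<Rightarrow> 'e"
  assumes emb_add: "\<iota> (x + y) = \<iota> x + \<iota> y"
    and emb_mult: "\<iota> (x * y) = \<iota> x * \<iota> y"
    and emb_one: "\<iota> 1 = 1"
    and basis: "\<exists>!c :: 'n \<Rightarrow> 'f. z = (\<Sum>k\<in>UNIV. \<iota> (c k) * b k)"
begin

definition coord :: "'e \<Rightarrow> 'n \<Rightarrow> 'f" where
  "coord z = (THE c. z = (\<Sum>k\<in>UNIV. \<iota> (c k) * b k))"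

text \<open>The norm of \<open>z\<close> is the determinant of multiplication by \<open>z\<close>; it does not depend
  on the basis.\<close>

definition mult_matrix :: "'e \<Rightarrow> 'f^'n^'n" where
  "mult_matrix z = (\<chi> k l. coord (z * b l) k)"

definition Norm :: "'e \<Rightarrow> 'f" where "Norm z = det (mult_matrix z)"

text \<open>The ring of integers is the integral closure of \<open>O_F\<close> in \<open>E\<close>.\<close>

definition O_E :: "'e set" where
  "O_E = {z. \<exists>P :: 'f Polynomial.poly.
      Polynomial.lead_coeff P = 1 \<and> (\<forall>k. Polynomial.coeff P k \<in> O_F) \<and>
      Polynomial.poly (map_poly \<iota> P) z = 0}"

definition O_E_units :: "'e set" where "O_E_units = {z \<in> O_E. \<exists>w\<in>O_E. z * w = 1}"

definition p_E :: "'e set" where "p_E = O_E - O_E_units"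

text \<open>Powers of the fractional ideal \<open>p_E\<close>; \<open>\<pi>\<close> ranges over the uniformisers, whose
  choice does not matter.\<close>

definition p_E_pow :: "int \<Rightarrow> 'e set" where
  "p_E_pow n = {z. \<exists>\<pi> a. p_E = (\<lambda>u. \<pi> * u) ` O_E \<and> a \<in> O_E \<and> z = \<pi> powi n * a}"

definition E_topology :: "'e topology" where
  "E_topology = topology (\<lambda>U. \<forall>z\<in>U. \<exists>n. \<forall>w. w - z \<in> p_E_pow n \<longrightarrow> w \<in> U)"

text \<open>Reduction modulo \<open>p_E\<close> for a totally ramified extension, whose residue field is
  identified with that of \<open>F\<close>: the residue class of \<open>F\<close> that corresponds to \<open>z\<close>.\<close>

definition red :: "'e \<Rightarrow> 'f set" where "red z = {a \<in> O_F. \<iota> a - z \<in> p_E}"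

end

definition is_subfield :: "'e::field set \<Rightarrow> bool" where
  "is_subfield S \<longleftrightarrow> 0 \<in> S \<and> 1 \<in> S \<and>
     (\<forall>x\<in>S. \<forall>y\<in>S. x - y \<in> S \<and> x * y \<in> S) \<and> (\<forall>x\<in>S. inverse x \<in> S)"

text \<open>The field \<open>'e\<close>, with the embedding \<open>\<iota>\<close>, is a splitting field of \<open>P\<close> over \<open>'f\<close>.\<close>

definition is_splitting_field ::
    "('f::field \<Rightarrow> 'e::field) \<Rightarrow> 'f Polynomial.poly \<Rightarrow> bool" where
  "is_splitting_field \<iota> P \<longleftrightarrow>
     (\<exists>c rs. map_poly \<iota> P = Polynomial.smult c (\<Prod>r\<leftarrow>rs. [:- r, 1:])) \<and>
     (\<forall>S. is_subfield S \<and> range \<iota> \<subseteq> S \<and> {z. Polynomial.poly (map_poly \<iota> P) z = 0} \<subseteq> S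
        \<longrightarrow> S = UNIV)"

text \<open>Left Haar measures on the Borel sets of a locally compact group \<open>G\<close> with topology \<open>T\<close>.
  Regularity is not required: it is automatic for second countable groups, such as the closed
  subgroups of matrix groups over local fields to which this is applied.\<close>

definition is_haar_measure :: "'g monoid \<Rightarrow> 'g topology \<Rightarrow> 'g measure \<Rightarrow> bool" where
  "is_haar_measure G T \<mu> \<longleftrightarrow>
     space \<mu> = topspace T \<and>
     sets \<mu> = sigma_sets (topspace T) {U. openin T U} \<and>
     emeasure \<mu> (topspace T) \<noteq> 0 \<and>
     (\<forall>C. compactin T C \<longrightarrow> emeasure \<mu> C < \<infinity>) \<and>
     (\<forall>g\<in>topspace T. \<forall>A\<in>sets \<mu>. emeasure \<mu> ((\<lambda>x. g \<otimes>\<^bsub>G\<^esub> x) ` A) = emeasure \<mu> A)"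

definition diag2 :: "'a::zero \<Rightarrow> 'a \<Rightarrow> 'a^2^2" where
  "diag2 x y = vector [vector [x, 0], vector [0, y]]"

text \<open>The standing data. The complex number \<open>im\<close> is the chosen square root of -1.\<close>

locale counterexample_setting =
  E2: local_field_ext v \<iota>2 b2 + E4: local_field_ext v \<iota>4 b4
  for v :: "'f::field \<Rightarrow> int"
    and \<iota>2 :: "'f \<Rightarrow> 'e2::field" and b2 :: "2 \<Rightarrow> 'e2"
    and \<iota>4 :: "'f \<Rightarrow> 'e4::field" and b4 :: "4 \<Rightarrow> 'e4" +
  fixes p :: nat and \<pi>_F \<zeta> :: 'f and im :: complex and \<eta> :: "'f \<Rightarrow> complex"
  assumes residue_char: "Factorial_Ring.prime p" "odd p" "of_nat p \<in> E2.p_F"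
    and four_dvd: "4 dvd E2.q_F - 1"
    and uniformizer: "\<pi>_F \<noteq> 0" "v \<pi>_F = 1"
    and root_of_unity: "\<zeta> ^ (E2.q_F - 1) = 1"
    and primitive: "\<And>k. 0 < k \<Longrightarrow> k < E2.q_F - 1 \<Longrightarrow> \<zeta> ^ k \<noteq> 1"
    and im: "im ^ 2 = -1"
    and \<eta>_character: "\<And>x y. x \<noteq> 0 \<Longrightarrow> y \<noteq> 0 \<Longrightarrow> \<eta> (x * y) = \<eta> x * \<eta> y"
      "\<And>x. x \<noteq> 0 \<Longrightarrow> \<eta> x \<noteq> 0"
    and \<eta>_uniformizer: "\<eta> \<pi>_F = 1"
    and \<eta>_principal_units: "\<And>x. x \<in> E2.p_F \<Longrightarrow> \<eta> (1 + x) = 1"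
    and \<eta>_root_of_unity: "\<eta> \<zeta> = im"
    and E2_splitting: "is_splitting_field \<iota>2 [:\<pi>_F, 0, 1:]"
    and E4_splitting: "is_splitting_field \<iota>4 [:\<zeta> * \<pi>_F, 0, 0, 0, 1:]"
begin

definition G0 :: "(('e2^2^2) \<times> 'e4) monoid" where
  "G0 = \<lparr>carrier = {(g2, g4). det g2 \<noteq> 0 \<and> g4 \<noteq> 0 \<and> E2.Norm (det g2) * E4.Norm g4 = 1},
         mult = (\<lambda>(g2, g4) (h2, h4). (g2 ** h2, g4 * h4)),
         one = (mat 1, 1)\<rparr>"

definition G0_topology :: "(('e2^2^2) \<times> 'e4) topology" where
  "G0_topology = subtopology
     (prod_topology
       (pullback_topology UNIV (\<lambda>g (i, j). g $ i $ j)
         (product_topology (\<lambda>_ :: 2 \<times> 2. E2.E_topology) UNIV))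
       E4.E_topology)
     (carrier G0)"

definition M0 :: "(('e2^2^2) \<times> 'e4) set" where
  "M0 = {(diag2 x y, z) | x y z. True} \<inter> carrier G0"

text \<open>The embedding into 8 by 8 matrices over \<open>F\<close> given by the two bases, that is, the matrix of
  \<open>(g2, g4)\<close> acting on the \<open>F\<close>-vector space \<open>E2 \<oplus> E2 \<oplus> E4\<close>, with coefficients
  extended to the algebraic closure.\<close>

definition embed8 :: "('e2^2^2) \<times> 'e4 \<Rightarrow> 'f alg_closure^(2 \<times> 2 + 4)^(2 \<times> 2 + 4)" where
  "embed8 = (\<lambda>(g2, g4). \<chi> r c.
     (case (r, c) of
        (Inl (i, k), Inl (j, l)) \<Rightarrow> to_ac (E2.mult_matrix (g2 $ i $ j) $ k $ l)
      | (Inr k, Inr l) \<Rightarrow> to_ac (E4.mult_matrix g4 $ k $ l)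
      | _ \<Rightarrow> 0))"

text \<open>The points of the algebraic group \<open>M0\<close> over the algebraic closure of \<open>F\<close>: the matrices of
  determinant 1 in the scalar extension of the algebra \<open>E2 \<times> E2 \<times> E4\<close>.\<close>

definition M0_alg_closure :: "('f alg_closure^(2 \<times> 2 + 4)^(2 \<times> 2 + 4)) set" where
  "M0_alg_closure =
     {A \<in> module.span (\<lambda>c A. \<chi> r s. c * A $ r $ s) (embed8 ` {(diag2 x y, z) | x y z. True}).
       det A = 1}"

text \<open>The rational points of the normaliser of the algebraic group \<open>M0\<close> in \<open>G0\<close>. As \<open>M0\<close> is
  smooth, it is enough to test the points of \<open>M0\<close> over the algebraic closure.\<close>

definition normalizer_M0 :: "(('e2^2^2) \<times> 'e4) set" where
  "normalizer_M0 = {n \<in> carrier G0.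
     (\<lambda>A. embed8 n ** A ** embed8 (inv\<^bsub>G0\<^esub> n)) ` M0_alg_closure = M0_alg_closure}"

definition I2 :: "('e2^2^2) set" where
  "I2 = {g. det g \<noteq> 0 \<and> g $ 1 $ 1 \<in> E2.O_E_units \<and> g $ 2 $ 2 \<in> E2.O_E_units \<and>
            g $ 1 $ 2 \<in> E2.O_E \<and> g $ 2 $ 1 \<in> E2.p_E}"

definition K_st :: "(('e2^2^2) \<times> 'e4) set" where
  "K_st = (I2 \<times> E4.O_E_units) \<inter> carrier G0"

definition K_par :: "(('e2^2^2) \<times> 'e4) set" where
  "K_par = {(g2, g4) \<in> K_st.
     E2.red (det g2) \<otimes>\<^bsub>E2.res_field\<^esub> (E4.red g4 [^]\<^bsub>E2.res_field\<^esub> (2::nat))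
       = \<one>\<^bsub>E2.res_field\<^esub>}"

text \<open>Everything below depends on the compact open subgroup \<open>K\<close> (one of the two above)
  through \<open>K_M0 K\<close>.\<close>

definition K_M0 :: "(('e2^2^2) \<times> 'e4) set \<Rightarrow> (('e2^2^2) \<times> 'e4) set" where
  "K_M0 K = K \<inter> M0"

definition \<rho>_M0 :: "('e2^2^2) \<times> 'e4 \<Rightarrow> complex" where
  "\<rho>_M0 g = \<eta> (E2.Norm (fst g $ 2 $ 2))"

definition conj_set :: "('e2^2^2) \<times> 'e4 \<Rightarrow> (('e2^2^2) \<times> 'e4) set \<Rightarrow> (('e2^2^2) \<times> 'e4) set" where
  "conj_set n A = (\<lambda>x. n \<otimes>\<^bsub>G0\<^esub> x \<otimes>\<^bsub>G0\<^esub> inv\<^bsub>G0\<^esub> n) ` A"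

definition N_rho :: "(('e2^2^2) \<times> 'e4) set \<Rightarrow> (('e2^2^2) \<times> 'e4) set" where
  "N_rho K = {n \<in> normalizer_M0. conj_set n (K_M0 K) = K_M0 K \<and>
     (\<forall>x\<in>K_M0 K. \<rho>_M0 (inv\<^bsub>G0\<^esub> n \<otimes>\<^bsub>G0\<^esub> x \<otimes>\<^bsub>G0\<^esub> n) = \<rho>_M0 x)}"

definition W_rho :: "(('e2^2^2) \<times> 'e4) set \<Rightarrow> (('e2^2^2) \<times> 'e4) set monoid" where
  "W_rho K = G0\<lparr>carrier := N_rho K\<rparr> Mod K_M0 K"

definition K_plus :: "int \<Rightarrow> (('e2^2^2) \<times> 'e4) set" where
  "K_plus i = {(g2, g4) \<in> carrier G0.
     g2 $ 1 $ 1 - 1 \<in> E2.p_E \<and> g2 $ 2 $ 2 - 1 \<in> E2.p_E \<and>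
     g2 $ 1 $ 2 \<in> E2.p_E_pow (- i) \<and> g2 $ 2 $ 1 \<in> E2.p_E_pow (i + 1) \<and>
     g4 - 1 \<in> E4.p_E}"

definition K_ch :: "(('e2^2^2) \<times> 'e4) set \<Rightarrow> int \<Rightarrow> (('e2^2^2) \<times> 'e4) set" where
  "K_ch K i = K_M0 K <#>\<^bsub>G0\<^esub> K_plus i"

definition \<rho>_ch :: "(('e2^2^2) \<times> 'e4) set \<Rightarrow> int \<Rightarrow> ('e2^2^2) \<times> 'e4 \<Rightarrow> complex" where
  "\<rho>_ch K i k = (THE c. \<exists>m\<in>K_M0 K. \<exists>u\<in>K_plus i. k = m \<otimes>\<^bsub>G0\<^esub> u \<and> c = \<rho>_M0 m)"

text \<open>Functions on \<open>G0\<close> are represented by functions on the ambient type that vanish outside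
  the carrier.\<close>

definition ind :: "(('e2^2^2) \<times> 'e4) set \<Rightarrow> int \<Rightarrow> (('e2^2^2) \<times> 'e4 \<Rightarrow> complex) set" where
  "ind K i = {f.
     (\<forall>g. g \<notin> carrier G0 \<longrightarrow> f g = 0) \<and>
     compactin G0_topology (G0_topology closure_of {g \<in> carrier G0. f g \<noteq> 0}) \<and>
     (\<forall>k\<in>K_ch K i. \<forall>g\<in>carrier G0. f (k \<otimes>\<^bsub>G0\<^esub> g) = \<rho>_ch K i k * f g)}"

text \<open>The operator from \<open>ind K i\<close> to \<open>ind K j\<close>; its formula does not involve the source \<open>i\<close>.
  Here \<open>\<mu> j\<close> is a Haar measure on \<open>K_plus j\<close>.\<close>

definition Theta ::
    "(int \<Rightarrow> (('e2^2^2) \<times> 'e4) measure) \<Rightarrow> int \<Rightarrow>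
      (('e2^2^2) \<times> 'e4 \<Rightarrow> complex) \<Rightarrow> ('e2^2^2) \<times> 'e4 \<Rightarrow> complex" where
  "Theta \<mu> j f g = (if g \<in> carrier G0 then (LINT k|\<mu> j. f (k \<otimes>\<^bsub>G0\<^esub> g)) else 0)"

definition relevant_wall ::
    "(('e2^2^2) \<times> 'e4) set \<Rightarrow> (int \<Rightarrow> (('e2^2^2) \<times> 'e4) measure) \<Rightarrow> int \<Rightarrow> bool" where
  "relevant_wall K \<mu> i \<longleftrightarrow>
     \<not> (\<exists>c. \<forall>f\<in>ind K i. Theta \<mu> i (Theta \<mu> (i + 1) f) = (\<lambda>g. c * f g)) \<or>
     \<not> (\<exists>c. \<forall>f\<in>ind K (i + 1). Theta \<mu> (i + 1) (Theta \<mu> i f) = (\<lambda>g. c * f g))"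

text \<open>Wall \<open>i\<close> is the one between the adjacent chambers \<open>i\<close> and \<open>i + 1\<close>.\<close>

definition separates :: "int \<Rightarrow> int \<Rightarrow> int \<Rightarrow> bool" where
  "separates i j k \<longleftrightarrow> min j k \<le> i \<and> i < max j k"

definition act_chamber :: "(('e2^2^2) \<times> 'e4) set \<Rightarrow> int \<Rightarrow> int" where
  "act_chamber w i = (THE j. \<forall>n\<in>w. conj_set n (K_plus i) = K_plus j)"

definition length_rel ::
    "(('e2^2^2) \<times> 'e4) set \<Rightarrow> (int \<Rightarrow> (('e2^2^2) \<times> 'e4) measure) \<Rightarrow> (('e2^2^2) \<times> 'e4) set \<Rightarrow> nat" where
  "length_rel K \<mu> w = card {i. relevant_wall K \<mu> i \<and> separates i 0 (act_chamber w 0)}"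

definition Omega_rho ::
    "(('e2^2^2) \<times> 'e4) set \<Rightarrow> (int \<Rightarrow> (('e2^2^2) \<times> 'e4) measure) \<Rightarrow> (('e2^2^2) \<times> 'e4) set set" where
  "Omega_rho K \<mu> = {w \<in> carrier (W_rho K). length_rel K \<mu> w = 0}"

end

end

theory Submission
  imports Defs
begin

text \<open>No wall is relevant, so every length vanishes. The composite of the two operators across a wall
  is a double sum of \<open>f (u g)\<close> over \<open>u\<close> running through products of upper and lower unipotent
  matrices with entries \<open>a\<close>, \<open>b\<close> in the residue field. If \<open>1 + a b \<noteq> 0\<close>, then \<open>u\<close> factors as lower
  unipotent times \<open>diag (1 + a b, 1 / (1 + a b))\<close> times upper unipotent, otherwise as the torus element
  of \<open>a\<close> times an element that does not depend on \<open>a\<close>. On the torus elements \<open>f\<close> transforms by the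
  character \<open>\<eta> \<circ> N\<close> of \<open>E\<^sub>2\<close>, which is the nontrivial quadratic character of the residue field because
  \<open>N \<zeta> = \<zeta>\<^sup>2\<close> and \<open>\<eta> (\<zeta>\<^sup>2) = -1\<close>. The character sums therefore cancel everything except a multiple
  of \<open>f g\<close>.\<close>

text \<open>The cancellation is rank one theory over the residue field: across a wall the two
  operators are the standard intertwiners between opposite principal series of SL_2, and their
  composite is scalar once the inducing character is nontrivial on the coroot torus. The coroot
  elements \<open>diag (t, 1 / t)\<close> have determinant 1, so they satisfy the parahoric
  condition as well; a single argument therefore treats both compact groups. Nontriviality comes
  from ramification: the residue field of \<open>E2\<close> is that of the base field, so residue
  classes are represented in the base field, where the norm is squaring, while \<open>\<eta>\<close>
  takes a value of order 4 at \<open>\<zeta>\<close>. The integrals become finite sums because the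
  integrands are invariant under the intersection of the groups of two adjacent chambers, whose
  cosets are indexed by the residue field. The preliminary obstacle is that the norm is given
  through an arbitrary basis and the integers through integral closure; explicit coordinates with
  respect to \<open>1\<close> and a square root of \<open>- \<pi>_F\<close> have to be recovered
  before anything can be computed.\<close>

unbundle no Formal_Power_Series.fps_syntax

section \<open>Discretely valued fields\<close>

context discretely_valued_field
begin

lemma v_one: "v 1 = 0"
  using v_mult[of 1 1] by simp

lemma v_inverse: "x \<noteq> 0 \<Longrightarrow> v (inverse x) = - v x"
  using v_mult[of x "inverse x"] by (simp add: v_one)

lemma v_divide: "x \<noteq> 0 \<Longrightarrow> y \<noteq> 0 \<Longrightarrow> v (x / y) = v x - v y"
  by (simp add: divide_inverse v_mult v_inverse)

lemma v_power: "x \<noteq> 0 \<Longrightarrow> v (x ^ n) = int n * v x"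
  by (induction n) (auto simp: v_one v_mult algebra_simps)

lemma v_power_int: "x \<noteq> 0 \<Longrightarrow> v (x powi n) = n * v x"
  by (cases n) (auto simp: power_int_def v_power v_inverse algebra_simps)

lemma v_minus: "v (- x) = v x"
proof (cases "x = 0")
  case False
  have "2 * v (- 1) = 0"
    using v_mult[of "-1" "-1"] by (simp add: v_one)
  then show ?thesis
    using v_mult[of "-1" x] False by simp
qed simp

text \<open>Zero belongs to every ball, so the junk value \<open>v 0\<close> never enters a
  computation.\<close>

definition v_ball :: "int \<Rightarrow> 'f set" where "v_ball n = {x. x = 0 \<or> n \<le> v x}"

lemma O_F_eq_v_ball: "O_F = v_ball 0" and p_F_eq_v_ball: "p_F = v_ball 1"
  by (auto simp: O_F_def p_F_def v_ball_def)

lemma v_ball_0: "0 \<in> v_ball n"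
  by (simp add: v_ball_def)

lemma v_ball_add: "x \<in> v_ball n \<Longrightarrow> y \<in> v_ball n \<Longrightarrow> x + y \<in> v_ball n"
  using v_add[of x y] by (force simp: v_ball_def)

lemma v_ball_double: "x \<in> v_ball n \<Longrightarrow> 2 * x \<in> v_ball n"
  unfolding mult_2 by (rule v_ball_add)

lemma v_ball_uminus: "x \<in> v_ball n \<Longrightarrow> - x \<in> v_ball n"
  by (auto simp: v_ball_def v_minus)

lemma v_ball_diff: "x \<in> v_ball n \<Longrightarrow> y \<in> v_ball n \<Longrightarrow> x - y \<in> v_ball n"
  using v_ball_add[of x n "- y"] by (simp add: v_ball_uminus)

lemma v_ball_minus_commute: "x - y \<in> v_ball n \<longleftrightarrow> y - x \<in> v_ball n"
  using v_ball_uminus[of "x - y" n] v_ball_uminus[of "y - x" n] by auto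

lemma v_ball_mult: "x \<in> v_ball m \<Longrightarrow> y \<in> v_ball n \<Longrightarrow> m + n = k \<Longrightarrow> x * y \<in> v_ball k"
  by (cases "x = 0 \<or> y = 0") (auto simp: v_ball_def v_mult)

lemma v_ball_mult_unit:
  "x \<in> v_ball 0 \<Longrightarrow> y \<in> v_ball n \<Longrightarrow> x * y \<in> v_ball n"
  "x \<in> v_ball n \<Longrightarrow> y \<in> v_ball 0 \<Longrightarrow> x * y \<in> v_ball n"
  by (auto intro: v_ball_mult)

lemma v_ball_antimono: "m \<le> n \<Longrightarrow> x \<in> v_ball n \<Longrightarrow> x \<in> v_ball m"
  by (auto simp: v_ball_def)

lemma v_ball_sum: "(\<And>k. k \<in> A \<Longrightarrow> f k \<in> v_ball n) \<Longrightarrow> sum f A \<in> v_ball n"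
  by (induction A rule: infinite_finite_induct) (auto simp: v_ball_0 v_ball_add)

lemma v_ball_1: "1 \<in> v_ball 0"
  by (simp add: v_ball_def v_one)

lemma v_ball_pos_imp: "x \<in> v_ball 1 \<Longrightarrow> x \<in> v_ball 0"
  by (rule v_ball_antimono[of 0 1]) auto

lemma v_unit_iff: "x \<in> v_ball 0 \<Longrightarrow> x \<notin> v_ball 1 \<longleftrightarrow> x \<noteq> 0 \<and> v x = 0"
  by (auto simp: v_ball_def)

text \<open>Reading \<open>x\<close> as \<open>(x + y) + (- y)\<close> gives the converse bound: the
  minimum there cannot be attained at \<open>- y\<close>, whose valuation exceeds that of
  \<open>x\<close>.\<close>

lemma v_add_of_less:
  assumes "x \<noteq> 0" "y = 0 \<or> v x < v y"
  shows "x + y \<noteq> 0" "v (x + y) = v x"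
proof -
  show nz: "x + y \<noteq> 0"
    using assms v_minus[of y] by (auto simp: add_eq_0_iff)
  show "v (x + y) = v x"
  proof (cases "y = 0")
    case False
    have "min (v (x + y)) (v (- y)) \<le> v x"
      using v_add[of "x + y" "- y"] nz False assms by simp
    moreover have "min (v x) (v y) \<le> v (x + y)"
      using v_add[of x y] nz False assms by simp
    ultimately show ?thesis
      using False assms by (auto simp: v_minus)
  qed simp
qed

lemma v_ball_one_add:
  assumes "x \<in> v_ball 1"
  shows "1 + x \<noteq> 0" "v (1 + x) = 0"
  using v_add_of_less[of 1 x] assms by (auto simp: v_ball_def v_one)

text \<open>A finite stand-in for the residue field: summing over \<open>R\<close> is summing over
  residue classes, with summands evaluated at actual field elements.\<close>

definition residue_reps :: "'f set \<Rightarrow> bool" where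
  "residue_reps R \<longleftrightarrow> R \<subseteq> O_F \<and> finite R \<and> (\<forall>x\<in>O_F. \<exists>!r. r \<in> R \<and> x - r \<in> p_F)"

text \<open>For \<open>v x < 0\<close> the leading term of a monic integral polynomial has valuation
  strictly below all other terms, so nothing can cancel it.\<close>

lemma O_F_integrally_closed:
  assumes "Polynomial.lead_coeff P = 1" "\<And>k. Polynomial.coeff P k \<in> O_F" "Polynomial.poly P x = 0"
  shows "x \<in> O_F"
proof (rule ccontr)
  assume "x \<notin> O_F"
  then have x: "x \<noteq> 0" "v x < 0" by (auto simp: O_F_def)
  define n where "n = Polynomial.degree P"
  have n: "n \<noteq> 0"
  proof
    assume "n = 0"
    then have "Polynomial.poly P x = Polynomial.coeff P 0"
      by (simp add: n_def poly_altdef)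
    then show False
      using assms \<open>n = 0\<close> by (simp add: n_def)
  qed
  \<comment> \<open>As \<open>v x < 0\<close>, the smallest of the bounds \<open>k * v x\<close>
    with \<open>k < n\<close> is the one at \<open>k = n - 1\<close>.\<close>
  have "(\<Sum>k<n. Polynomial.coeff P k * x ^ k) \<in> v_ball (int (n - 1) * v x)"
  proof (rule v_ball_sum)
    fix k assume "k \<in> {..<n}"
    then have "int (n - 1) * v x \<le> int k * v x"
      using x by (intro mult_right_mono_neg) auto
    then show "Polynomial.coeff P k * x ^ k \<in> v_ball (int (n - 1) * v x)"
      using assms(2)[of k] x
      by (cases "Polynomial.coeff P k = 0")
        (auto simp: O_F_def v_ball_def v_mult v_power intro: add_increasing)
  qed
  moreover have "x ^ n = - (\<Sum>k<n. Polynomial.coeff P k * x ^ k)"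
    using assms(1,3) unfolding poly_altdef n_def
    by (simp add: lessThan_Suc_atMost[symmetric] add_eq_0_iff2 add.commute)
  ultimately have "x ^ n \<in> v_ball (int (n - 1) * v x)"
    using v_ball_uminus by presburger
  moreover have "x ^ n \<noteq> 0"
    using x by simp
  ultimately have "int (n - 1) * v x \<le> int n * v x"
    unfolding v_ball_def v_power[OF x(1), symmetric] by blast
  moreover have "int (n - 1) = int n - 1"
    using n by simp
  ultimately show False
    using x by (simp add: left_diff_distrib del: mult_le_cancel_right)
qed

end

section \<open>The residue field and its representatives\<close>

context nonarch_local_field
begin

lemma res_ring: "ring \<lparr>carrier = O_F, mult = (*), one = 1, zero = 0, add = (+)\<rparr>" (is "ring ?R")
proof -
  have "\<exists>y\<in>O_F. y + x = 0" if "x \<in> O_F" for x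
    using that v_ball_uminus[of x 0] by (intro bexI[of _ "- x"]) (auto simp: O_F_eq_v_ball)
  then show ?thesis
    by (intro ringI abelian_groupI monoidI)
      (simp_all add: O_F_eq_v_ball v_ball_0 v_ball_1 v_ball_add v_ball_mult_unit algebra_simps)
qed

lemma res_ideal: "ideal p_F \<lparr>carrier = O_F, mult = (*), one = 1, zero = 0, add = (+)\<rparr>"
  (is "ideal _ ?R")
proof -
  interpret R: ring ?R by (rule res_ring)
  have minus: "\<ominus>\<^bsub>?R\<^esub> x = - x" if "x \<in> O_F" for x
    using that by (intro R.minus_equality) (auto simp: O_F_eq_v_ball v_ball_uminus)
  have "subgroup p_F (add_monoid ?R)"
  proof (rule R.add.subgroupI)
    fix x assume "x \<in> p_F"
    then show "\<ominus>\<^bsub>?R\<^esub> x \<in> p_F"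
      using minus[of x] by (simp add: O_F_eq_v_ball p_F_eq_v_ball v_ball_pos_imp v_ball_uminus)
  next
    show "p_F \<subseteq> carrier ?R"
      by (auto simp: O_F_eq_v_ball p_F_eq_v_ball v_ball_pos_imp)
    show "p_F \<noteq> {}"
      using v_ball_0 by (auto simp: p_F_eq_v_ball)
  qed (simp add: p_F_eq_v_ball v_ball_add)
  then show ?thesis
    by (intro idealI res_ring) (simp_all add: O_F_eq_v_ball p_F_eq_v_ball v_ball_mult_unit)
qed

lemma res_field_ring: "ring res_field"
  unfolding res_field_def by (rule ideal.quotient_is_ring[OF res_ideal])

lemma res_coset:
  "p_F +>\<^bsub>\<lparr>carrier = O_F, mult = (*), one = 1, zero = 0, add = (+)\<rparr>\<^esub> x = {y. y - x \<in> p_F}"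
proof -
  have "y \<in> {y. \<exists>h\<in>p_F. y = h + x}" if "y - x \<in> p_F" for y
    using that by (intro CollectI bexI[of _ "y - x"]) simp_all
  then show ?thesis
    by (auto simp: a_r_coset_def')
qed

lemma res_field_one: "\<one>\<^bsub>res_field\<^esub> = {x. x - 1 \<in> p_F}"
  by (simp add: res_field_def FactRing_def res_coset)

lemma residue_reps_exist: "\<exists>R. residue_reps R"
proof -
  let ?c = "\<lambda>x. {y. y - x \<in> p_F}"
  have car: "carrier res_field = ?c ` O_F"
    by (auto simp: res_field_def FactRing_def A_RCOSETS_def' res_coset)
  \<comment> \<open>Choosing once per coset, and not once per element, makes two representatives of
    the same class equal.\<close>
  define s where "s C = (SOME x. x \<in> C \<inter> O_F)" for C
  have s: "s (?c x) - x \<in> p_F \<and> s (?c x) \<in> O_F" if "x \<in> O_F" for x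
  proof -
    have "x \<in> ?c x \<inter> O_F"
      using that by (simp add: p_F_def)
    from someI[of "\<lambda>y. y \<in> ?c x \<inter> O_F", OF this] show ?thesis
      by (simp add: s_def)
  qed
  have eq: "?c x = ?c y" if "x - y \<in> p_F" for x y
  proof -
    have "z - y \<in> p_F \<longleftrightarrow> z - x \<in> p_F" for z
      using v_ball_add[of "z - x" 1 "x - y"] v_ball_diff[of "z - y" 1 "x - y"] that
      by (auto simp: p_F_eq_v_ball)
    then show ?thesis by simp
  qed
  let ?R = "(\<lambda>x. s (?c x)) ` O_F"
  have "\<exists>!r. r \<in> ?R \<and> x - r \<in> p_F" if x: "x \<in> O_F" for x
  proof (rule ex1I[of _ "s (?c x)"])
    show "s (?c x) \<in> ?R \<and> x - s (?c x) \<in> p_F"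
      using x s[OF x] by (auto simp: p_F_eq_v_ball v_ball_minus_commute[of x])
  next
    fix r assume r: "r \<in> ?R \<and> x - r \<in> p_F"
    then obtain y where y: "y \<in> O_F" "r = s (?c y)" by auto
    have "x - y \<in> p_F"
      using v_ball_add[of "x - r" 1 "r - y"] r y s[of y] by (auto simp: p_F_eq_v_ball)
    from eq[OF this] show "r = s (?c x)"
      using y by simp
  qed
  moreover have "finite ?R"
    using finite_imageI[OF finite_residue_field[unfolded car], of s] by (simp add: image_image)
  moreover have "?R \<subseteq> O_F"
    using s by auto
  ultimately show ?thesis
    unfolding residue_reps_def by (intro exI[of _ ?R] conjI ballI)
qed

end

section \<open>Finite extensions of local fields\<close>

context local_field_ext
begin

lemma emb_zero: "\<iota> 0 = 0"
  using emb_add[of 0 0] by (metis add_0_right add_left_imp_eq)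

lemma emb_uminus: "\<iota> (- x) = - \<iota> x"
  using emb_add[of x "- x"] by (simp add: emb_zero add_eq_0_iff)

lemma emb_diff: "\<iota> (x - y) = \<iota> x - \<iota> y"
  using emb_add[of x "- y"] by (simp add: emb_uminus)

lemma emb_power: "\<iota> (x ^ n) = \<iota> x ^ n"
  by (induction n) (auto simp: emb_one emb_mult)

lemma emb_eq_0_iff: "\<iota> x = 0 \<longleftrightarrow> x = 0"
proof
  assume "\<iota> x = 0"
  then have "\<iota> (x * inverse x) = 0"
    by (simp add: emb_mult)
  then show "x = 0"
    by (cases "x = 0") (auto simp: emb_one)
qed (simp add: emb_zero)

lemma emb_eq_iff: "\<iota> x = \<iota> y \<longleftrightarrow> x = y"
  using emb_eq_0_iff[of "x - y"] by (simp add: emb_diff)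

lemma emb_inverse: "\<iota> (inverse x) = inverse (\<iota> x)"
  by (cases "x = 0") (auto simp: emb_zero emb_one emb_eq_0_iff emb_mult[symmetric] intro!: inverse_unique[symmetric])

lemma emb_divide: "\<iota> (x / y) = \<iota> x / \<iota> y"
  by (simp add: divide_inverse emb_mult emb_inverse)

section \<open>Coordinates, multiplication matrices and the norm\<close>

lemma coord_sum: "z = (\<Sum>k\<in>UNIV. \<iota> (coord z k) * b k)"
  unfolding coord_def by (rule theI'[OF basis])

lemma coord_unique: "z = (\<Sum>k\<in>UNIV. \<iota> (c k) * b k) \<Longrightarrow> coord z = c"
  using basis[of z] coord_sum[of z] by blast

lemma coord_eq_iff: "coord x = coord y \<longleftrightarrow> x = y"
  using coord_sum[of x] coord_sum[of y] by force

lemma coord_add: "coord (x + y) = (\<lambda>k. coord x k + coord y k)"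
  by (rule coord_unique)
    (subst coord_sum[of x], subst coord_sum[of y], simp add: emb_add distrib_right sum.distrib)

lemma coord_scale: "coord (\<iota> a * x) = (\<lambda>k. a * coord x k)"
  by (rule coord_unique) (subst coord_sum[of x], simp add: emb_mult sum_distrib_left mult.assoc)

lemma coord_sum_scale: "coord (\<Sum>k\<in>A. \<iota> (a k) * f k) l = (\<Sum>k\<in>A. a k * coord (f k) l)"
proof (induction A rule: infinite_finite_induct)
  case (insert x F)
  then show ?case by (simp add: coord_add coord_scale)
qed (use coord_scale[of 0 0] in \<open>auto simp: emb_zero\<close>)

lemma coord_basis: "coord (b l) k = (if k = l then 1 else 0)"
proof -
  have "coord (b l) = (\<lambda>k. if k = l then 1 else 0)"
    by (rule coord_unique) (simp add: if_distrib[of \<iota>] if_distrib[of "\<lambda>x. x * _"] emb_one emb_zero cong: if_cong)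
  then show ?thesis by simp
qed

lemma mult_matrix_mult: "mult_matrix (x * y) = mult_matrix x ** mult_matrix y"
proof -
  have "coord (x * y * b l) k = (\<Sum>j\<in>UNIV. coord (x * b j) k * coord (y * b l) j)" for k l
  proof -
    have "x * y * b l = (\<Sum>j\<in>UNIV. \<iota> (coord (y * b l) j) * (x * b j))"
      by (subst mult.assoc, subst coord_sum[of "y * b l"]) (simp add: sum_distrib_left algebra_simps)
    then have "coord (x * y * b l) k = coord (\<Sum>j\<in>UNIV. \<iota> (coord (y * b l) j) * (x * b j)) k"
      by simp
    then show ?thesis
      unfolding coord_sum_scale by (simp add: mult.commute)
  qed
  then show ?thesis
    by (simp add: mult_matrix_def matrix_matrix_mult_def vec_eq_iff)
qed

lemma mult_matrix_add: "mult_matrix (x + y) = mult_matrix x + mult_matrix y"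
  by (simp add: mult_matrix_def vec_eq_iff distrib_right coord_add)

lemma mult_matrix_emb: "mult_matrix (\<iota> a) = mat a"
  by (simp add: mult_matrix_def vec_eq_iff mat_def coord_scale coord_basis)

lemma Norm_mult: "Norm (x * y) = Norm x * Norm y"
  by (simp add: Norm_def mult_matrix_mult det_mul)

lemma Norm_one: "Norm 1 = 1"
  using mult_matrix_emb[of 1] by (simp add: Norm_def emb_one)

section \<open>Integral elements and the topology of an extension\<close>

lemma emb_O_E_iff: "\<iota> x \<in> O_E \<longleftrightarrow> x \<in> O_F"
proof -
  have poly: "Polynomial.poly (map_poly \<iota> P) (\<iota> x) = \<iota> (Polynomial.poly P x)" for P
    by (induction P) (auto simp: map_poly_pCons emb_zero emb_add emb_mult emb_eq_0_iff)
  show ?thesis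
  proof
    assume "\<iota> x \<in> O_E"
    then show "x \<in> O_F"
      using O_F_integrally_closed by (auto simp: O_E_def poly emb_eq_0_iff)
  next
    assume "x \<in> O_F"
    then have "Polynomial.coeff [:- x, 1:] k \<in> O_F" for k
      by (auto simp: coeff_pCons O_F_eq_v_ball v_ball_0 v_ball_1 v_ball_uminus split: nat.split)
    then show "\<iota> x \<in> O_E"
      by (auto simp: O_E_def poly emb_eq_0_iff intro!: exI[of _ "[:- x, 1:]"])
  qed
qed

text \<open>An inverse of \<open>\<iota> x\<close> in the extension is already
  \<open>\<iota> (inverse x)\<close>, so being a unit means the same in both rings.\<close>

lemma emb_p_E_iff: "\<iota> x \<in> p_E \<longleftrightarrow> x \<in> p_F"
proof -
  have "(\<exists>w\<in>O_E. \<iota> x * w = 1) \<longleftrightarrow> x \<noteq> 0 \<and> inverse x \<in> O_F"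
  proof
    assume "\<exists>w\<in>O_E. \<iota> x * w = 1"
    then obtain w where w: "w \<in> O_E" "\<iota> x * w = 1" by auto
    then have "x \<noteq> 0" "w = \<iota> (inverse x)"
      by (auto simp: emb_zero emb_inverse inverse_unique)
    then show "x \<noteq> 0 \<and> inverse x \<in> O_F"
      using w emb_O_E_iff by auto
  next
    assume "x \<noteq> 0 \<and> inverse x \<in> O_F"
    then show "\<exists>w\<in>O_E. \<iota> x * w = 1"
      by (intro bexI[of _ "\<iota> (inverse x)"]) (auto simp: emb_O_E_iff emb_one simp flip: emb_mult)
  qed
  then show ?thesis
    by (auto simp: p_E_def O_E_units_def emb_O_E_iff O_F_def p_F_def v_inverse)
qed

text \<open>For an element of determinant 1 with second component 1, the parahoric condition
  involves only this reduction.\<close>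

lemma red_one: "red 1 = \<one>\<^bsub>res_field\<^esub>"
proof -
  have "\<iota> a - 1 \<in> p_E \<longleftrightarrow> a - 1 \<in> p_F" for a
    using emb_p_E_iff[of "a - 1"] by (simp add: emb_diff emb_one)
  moreover have "a \<in> O_F" if "a - 1 \<in> p_F" for a
    using that v_ball_add[of "a - 1" 0 1] v_ball_1 v_ball_pos_imp[of "a - 1"]
    by (simp add: p_F_eq_v_ball O_F_eq_v_ball)
  ultimately show ?thesis
    by (auto simp: red_def res_field_one)
qed

lemma p_E_pow_antimono: "m \<le> n \<Longrightarrow> p_E_pow n \<subseteq> p_E_pow m"
proof
  fix z assume mn: "m \<le> n" and "z \<in> p_E_pow n"
  then obtain \<pi> a where z: "p_E = (\<lambda>u. \<pi> * u) ` O_E" "a \<in> O_E" "z = \<pi> powi n * a"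
    by (auto simp: p_E_pow_def)
  \<comment> \<open>A uniformiser of the base field maps to a nonzero element of \<open>p_E\<close>,
    so the generator \<open>\<pi>\<close> is nonzero and its negative powers cancel.\<close>
  obtain x where "x \<noteq> 0" "v x = 1"
    using v_normalised by auto
  then have "\<iota> x \<in> p_E" "\<iota> x \<noteq> 0"
    by (auto simp: emb_p_E_iff p_F_def emb_eq_0_iff)
  then have \<pi>: "\<pi> \<noteq> 0"
    using z(1) by auto
  have step: "\<pi> * u \<in> O_E" if "u \<in> O_E" for u
    using z(1) that by (auto simp: p_E_def)
  have "\<pi> ^ k * a \<in> O_E" for k
    by (induction k) (auto simp: z mult.assoc step)
  from this[of "nat (n - m)"] have "\<pi> powi (n - m) * a \<in> O_E"
    using mn by (simp add: power_int_def)
  moreover have "z = \<pi> powi m * (\<pi> powi (n - m) * a)"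
    using \<pi> mn power_int_add[of \<pi> m "n - m"] by (simp add: z)
  ultimately show "z \<in> p_E_pow m"
    using z(1) by (auto simp: p_E_pow_def)
qed

text \<open>\<open>topology\<close> is inverse to \<open>openin\<close> only on predicates
  satisfying \<open>istopology\<close>. Stability under intersection uses that the
  \<open>p_E_pow n\<close> form a decreasing chain.\<close>

lemma openin_E_topology:
  "openin E_topology U \<longleftrightarrow> (\<forall>z\<in>U. \<exists>n. \<forall>w. w - z \<in> p_E_pow n \<longrightarrow> w \<in> U)"
proof -
  have "istopology (\<lambda>U. \<forall>z\<in>U. \<exists>n. \<forall>w. w - z \<in> p_E_pow n \<longrightarrow> w \<in> U)"
    unfolding istopology_def
  proof (intro conjI allI impI ballI)
    fix S T z
    assume "\<forall>z\<in>S. \<exists>n. \<forall>w. w - z \<in> p_E_pow n \<longrightarrow> w \<in> S"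
      and "\<forall>z\<in>T. \<exists>n. \<forall>w. w - z \<in> p_E_pow n \<longrightarrow> w \<in> T" and "z \<in> S \<inter> T"
    then obtain m n where "\<forall>w. w - z \<in> p_E_pow m \<longrightarrow> w \<in> S" "\<forall>w. w - z \<in> p_E_pow n \<longrightarrow> w \<in> T"
      by (metis IntE)
    then show "\<exists>n. \<forall>w. w - z \<in> p_E_pow n \<longrightarrow> w \<in> S \<inter> T"
      using p_E_pow_antimono[of m "max m n"] p_E_pow_antimono[of n "max m n"]
      by (intro exI[of _ "max m n"]) auto
  next
    fix \<K> z
    assume "\<forall>K\<in>\<K>. \<forall>z\<in>K. \<exists>n. \<forall>w. w - z \<in> p_E_pow n \<longrightarrow> w \<in> K" "z \<in> \<Union> \<K>"
    then show "\<exists>n. \<forall>w. w - z \<in> p_E_pow n \<longrightarrow> w \<in> \<Union> \<K>"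
      by (meson UnionE UnionI)
  qed
  then show ?thesis
    by (simp add: E_topology_def)
qed

lemma topspace_E_topology: "topspace E_topology = UNIV"
  using openin_subset[of E_topology UNIV] by (auto simp: openin_E_topology)

end

section \<open>Ramified quadratic extensions\<close>

text \<open>The basis \<open>b\<close> is arbitrary and in general not \<open>1\<close>,
  \<open>\<omega>\<close>: it fixes the degree 2 and defines the norm, while \<open>\<omega>\<close>
  is a root of an Eisenstein polynomial.\<close>

locale ramified_quadratic_ext = local_field_ext v \<iota> b
  for v :: "'f::field \<Rightarrow> int" and \<iota> :: "'f \<Rightarrow> 'e::field" and b :: "2 \<Rightarrow> 'e" +
  fixes \<pi> :: 'f and \<omega> :: 'e
  assumes uniformizer: "\<pi> \<noteq> 0" "v \<pi> = 1"
    and root: "\<omega> ^ 2 = - \<iota> \<pi>"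
begin

lemma not_square: "x ^ 2 \<noteq> - \<pi>"
proof
  assume "x ^ 2 = - \<pi>"
  then have "v (x ^ 2) = 1" "x \<noteq> 0"
    using uniformizer by (auto simp: v_minus)
  then show False
    by (simp add: v_power) (metis dvd_triv_left odd_one)
qed

lemma root_not_emb: "\<omega> \<noteq> \<iota> x"
  using not_square[of x] root emb_eq_iff[of "x ^ 2" "- \<pi>"] by (auto simp: emb_power emb_uminus)

text \<open>Cramer's rule for the coordinates of \<open>1\<close> and \<open>\<omega>\<close> with
  respect to \<open>b\<close>; their determinant \<open>D\<close> could vanish only if
  \<open>\<omega>\<close> came from the base field.\<close>

lemma decomposition: "\<exists>x y. z = \<iota> x + \<iota> y * \<omega>"
proof -
  let ?p = "coord 1" and ?q = "coord \<omega>"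
  define D where "D = ?p 1 * ?q 2 - ?p 2 * ?q 1"
  have "D \<noteq> 0"
  proof
    assume D: "D = 0"
    \<comment> \<open>If \<open>D = 0\<close>, the coordinate vectors of \<open>1\<close> and
      \<open>\<omega>\<close> are proportional, so each coordinate of \<open>1\<close> yields a
      linear relation between \<open>1\<close> and \<open>\<omega>\<close>.\<close>
    have dep: "\<iota> (?p k) * \<omega> = \<iota> (?q k) * 1" for k
    proof -
      have "coord (\<iota> (?p k) * \<omega>) l = coord (\<iota> (?q k) * 1) l" for l
        unfolding coord_scale using D exhaust_2[of k] exhaust_2[of l] by (auto simp: D_def algebra_simps)
      then show ?thesis
        unfolding coord_eq_iff[symmetric] by (intro ext)
    qed
    have "?p k = 0" for k
    proof (rule ccontr)
      assume "?p k \<noteq> 0"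
      then have "\<omega> = \<iota> (?q k / ?p k)"
        using dep[of k] by (simp add: emb_divide emb_eq_0_iff field_simps)
      then show False
        using root_not_emb by blast
    qed
    then have "(1::'e) = 0"
      using coord_sum[of 1] by (simp add: emb_zero)
    then show False by simp
  qed
  let ?x = "(coord z 1 * ?q 2 - coord z 2 * ?q 1) / D"
  let ?y = "(?p 1 * coord z 2 - ?p 2 * coord z 1) / D"
  have "coord (\<iota> ?x * 1 + \<iota> ?y * \<omega>) l = coord z l" for l
  proof -
    have "D * coord (\<iota> ?x * 1 + \<iota> ?y * \<omega>) l = D * coord z l"
      unfolding coord_add coord_scale using \<open>D \<noteq> 0\<close> exhaust_2[of l]
      by (auto simp: field_simps) (auto simp: D_def algebra_simps)
    then show ?thesis
      using \<open>D \<noteq> 0\<close> by simp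
  qed
  then have "z = \<iota> ?x * 1 + \<iota> ?y * \<omega>"
    unfolding coord_eq_iff[symmetric] by (intro ext) simp
  then show ?thesis
    by (intro exI[of _ ?x] exI[of _ ?y]) simp
qed

text \<open>The matrix of \<open>\<omega>\<close> in the unknown basis has square
  \<open>- \<pi>\<close>, and this pins down its trace and determinant.\<close>

lemma Norm_eq: "Norm (\<iota> x + \<iota> y * \<omega>) = x ^ 2 + \<pi> * y ^ 2"
proof -
  define A where "A = mult_matrix \<omega>"
  have "A ** A = mat (- \<pi>)"
    using mult_matrix_mult[of \<omega> \<omega>] root mult_matrix_emb[of "- \<pi>"]
    by (simp add: A_def power2_eq_square emb_uminus)
  then have A: "A$1$1 * A$1$1 + A$1$2 * A$2$1 = - \<pi>" "A$1$2 * (A$1$1 + A$2$2) = 0"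
    "A$2$1 * (A$1$1 + A$2$2) = 0"
    by (auto simp: vec_eq_iff forall_2 matrix_matrix_mult_def sum_2 mat_def algebra_simps)
  \<comment> \<open>With nonzero trace both off-diagonal entries would vanish, and the square of a
    diagonal entry would be \<open>- \<pi>\<close>.\<close>
  have tr: "A$1$1 + A$2$2 = 0"
    using A not_square[of "A$1$1"] by (auto simp: power2_eq_square)
  have "mult_matrix (\<iota> x + \<iota> y * \<omega>) = mat x + mat y ** A"
    by (simp add: mult_matrix_add mult_matrix_mult mult_matrix_emb A_def)
  then have "Norm (\<iota> x + \<iota> y * \<omega>) = (x + y * A$1$1) * (x + y * A$2$2) - (y * A$1$2) * (y * A$2$1)"
    by (simp add: Norm_def det_2 matrix_matrix_mult_def sum_2 mat_def)
  also have "\<dots> = x ^ 2 + \<pi> * y ^ 2"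
  proof -
    have "A$2$2 = - (A$1$1)"
      using tr by (simp add: eq_neg_iff_add_eq_0 add.commute)
    then have "(x + y * A$1$1) * (x + y * A$2$2) - (y * A$1$2) * (y * A$2$1) =
        x ^ 2 - y ^ 2 * (A$1$1 * A$1$1 + A$1$2 * A$2$1)"
      by (simp add: power2_eq_square algebra_simps)
    then show ?thesis
      unfolding A(1) by (simp add: algebra_simps)
  qed
  finally show ?thesis .
qed

lemma Norm_emb: "Norm (\<iota> x) = x ^ 2"
  using Norm_eq[of x 0] by (simp add: emb_zero)

text \<open>The ramification index is 2, so the norm delivers an already normalised valuation:
  \<open>\<omega>\<close> has norm \<open>\<pi>\<close>, and \<open>w\<close> is twice
  \<open>v\<close> on the base field.\<close>

definition w :: "'e \<Rightarrow> int" where "w z = v (Norm z)"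

text \<open>The two summands of the norm form have valuations of opposite parity, so they never
  cancel.\<close>

lemma w_formula:
  "x \<noteq> 0 \<or> y \<noteq> 0 \<Longrightarrow>
    w (\<iota> x + \<iota> y * \<omega>) = (if y = 0 then 2 * v x else if x = 0 then 1 + 2 * v y else min (2 * v x) (1 + 2 * v y))"
proof -
  assume nz: "x \<noteq> 0 \<or> y \<noteq> 0"
  have vx: "v (x ^ 2) = 2 * v x" if "x \<noteq> 0"
    using that by (simp add: v_power)
  have vy: "v (\<pi> * y ^ 2) = 1 + 2 * v y" if "y \<noteq> 0"
    using that uniformizer by (simp add: v_power v_mult)
  consider "y = 0" | "x = 0" "y \<noteq> 0" | "x \<noteq> 0" "y \<noteq> 0" by blast
  then show ?thesis
  proof cases
    case 3
    consider "v x \<le> v y" | "v y < v x"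
      by linarith
    then show ?thesis
    proof cases
      case 1
      then show ?thesis
        using v_add_of_less(2)[of "x ^ 2" "\<pi> * y ^ 2"] 3 vx vy unfolding w_def Norm_eq by simp
    next
      case 2
      then show ?thesis
        using v_add_of_less(2)[of "\<pi> * y ^ 2" "x ^ 2"] 3 vx vy uniformizer
        unfolding w_def Norm_eq add.commute[of "x ^ 2"] by simp
    qed
  qed (use nz vx vy in \<open>simp_all add: w_def Norm_eq\<close>)
qed

lemma eq_0_iff: "\<iota> x + \<iota> y * \<omega> = 0 \<longleftrightarrow> x = 0 \<and> y = 0"
proof
  assume *: "\<iota> x + \<iota> y * \<omega> = 0"
  have "y = 0"
  proof (rule ccontr)
    assume "y \<noteq> 0"
    then have "\<omega> = \<iota> (- x / y)"
      using * by (simp add: emb_divide emb_uminus emb_eq_0_iff field_simps eq_neg_iff_add_eq_0)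
    then show False
      using root_not_emb by blast
  qed
  then show "x = 0 \<and> y = 0"
    using * by (simp add: emb_zero emb_eq_0_iff)
qed (simp add: emb_zero)

lemma w_ge_iff:
  "\<iota> x + \<iota> y * \<omega> = 0 \<or> n \<le> w (\<iota> x + \<iota> y * \<omega>) \<longleftrightarrow> (x = 0 \<or> n \<le> 2 * v x) \<and> (y = 0 \<or> n \<le> 1 + 2 * v y)"
  unfolding eq_0_iff using w_formula[of x y] by (cases "x = 0"; cases "y = 0") auto

sublocale W: discretely_valued_field w
proof
  show "w (x * y) = w x + w y" if "x \<noteq> 0" "y \<noteq> 0" for x y
  proof -
    have "Norm z \<noteq> 0" if "z \<noteq> 0" for z
      using Norm_mult[of z "inverse z"] Norm_one that by auto
    then show ?thesis
      using that by (simp add: w_def Norm_mult v_mult)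
  qed
next
  fix x y :: 'e
  assume nz: "x \<noteq> 0" "y \<noteq> 0" "x + y \<noteq> 0"
  obtain x1 x2 y1 y2 where xy: "x = \<iota> x1 + \<iota> x2 * \<omega>" "y = \<iota> y1 + \<iota> y2 * \<omega>"
    using decomposition by metis
  have s: "x + y = \<iota> (x1 + y1) + \<iota> (x2 + y2) * \<omega>"
    by (simp add: xy emb_add algebra_simps)
  define n where "n = min (w x) (w y)"
  \<comment> \<open>The coordinate bounds are n / 2 and (n - 1) / 2, both rounded up; the latter is
    \<open>n div 2\<close>. The ultrametric inequality for \<open>w\<close> thus reduces to that for
    \<open>v\<close> in each coordinate.\<close>
  have half: "z = 0 \<or> n \<le> 2 * v z \<longleftrightarrow> z \<in> v_ball ((n + 1) div 2)"
    "z = 0 \<or> n \<le> 1 + 2 * v z \<longleftrightarrow> z \<in> v_ball (n div 2)" for z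
    by (auto simp: v_ball_def)
  have "x = 0 \<or> n \<le> w x" "y = 0 \<or> n \<le> w y"
    by (auto simp: n_def)
  then have "x1 \<in> v_ball ((n + 1) div 2) \<and> x2 \<in> v_ball (n div 2)"
    "y1 \<in> v_ball ((n + 1) div 2) \<and> y2 \<in> v_ball (n div 2)"
    unfolding xy w_ge_iff half by auto
  then have "x + y = 0 \<or> n \<le> w (x + y)"
    unfolding s w_ge_iff half by (auto intro: v_ball_add)
  then show "min (w x) (w y) \<le> w (x + y)"
    using nz by (simp add: n_def)
next
  show "\<exists>x. x \<noteq> 0 \<and> w x = 1"
    using w_formula[of 0 1] eq_0_iff[of 0 1]
    by (intro exI[of _ \<omega>]) (simp add: emb_zero emb_one v_one)
qed

lemma root_nonzero: "\<omega> \<noteq> 0" and w_root: "w \<omega> = 1"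
  using w_formula[of 0 1] eq_0_iff[of 0 1] by (simp_all add: emb_zero emb_one v_one)

lemma w_emb: "x \<noteq> 0 \<Longrightarrow> w (\<iota> x) = 2 * v x"
  using w_formula[of x 0] by (simp add: emb_zero)

lemma W_ball_iff:
  "\<iota> x + \<iota> y * \<omega> \<in> W.v_ball n \<longleftrightarrow> (x = 0 \<or> n \<le> 2 * v x) \<and> (y = 0 \<or> n \<le> 1 + 2 * v y)"
  unfolding W.v_ball_def using w_ge_iff by simp

text \<open>One inclusion holds because the valuation ring of \<open>w\<close> is integrally closed,
  the other because elements of nonnegative valuation have integral trace and norm.\<close>

lemma O_E_eq: "O_E = W.v_ball 0"
proof
  show "O_E \<subseteq> W.v_ball 0"
  proof
    fix z assume "z \<in> O_E"
    then obtain P where P: "Polynomial.lead_coeff P = 1" "\<And>k. Polynomial.coeff P k \<in> O_F"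
      "Polynomial.poly (map_poly \<iota> P) z = 0"
      by (auto simp: O_E_def)
    have "Polynomial.degree (map_poly \<iota> P) = Polynomial.degree P"
      by (rule degree_map_poly) (simp add: emb_eq_0_iff)
    then have "Polynomial.lead_coeff (map_poly \<iota> P) = 1"
      using P(1) by (simp add: coeff_map_poly emb_zero emb_one)
    moreover have "Polynomial.coeff (map_poly \<iota> P) k \<in> W.O_F" for k
      using P(2)[of k] by (auto simp: coeff_map_poly emb_zero W.O_F_def O_F_def w_emb)
        (metis emb_zero w_emb mult_nonneg_nonneg zero_le_numeral)
    ultimately show "z \<in> W.v_ball 0"
      using W.O_F_integrally_closed P(3) unfolding W.O_F_eq_v_ball by blast
  qed
next
  show "W.v_ball 0 \<subseteq> O_E"
  proof
    fix z assume z: "z \<in> W.v_ball 0"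
    obtain x y where xy: "z = \<iota> x + \<iota> y * \<omega>"
      using decomposition by blast
    have O: "x \<in> v_ball 0" "y \<in> v_ball 0"
      using z unfolding xy W_ball_iff by (auto simp: v_ball_def)
    \<comment> \<open>The characteristic polynomial of \<open>z\<close>, with minus the trace as
      linear coefficient.\<close>
    let ?P = "[:x ^ 2 + \<pi> * y ^ 2, - x - x, 1:]"
    have \<pi>: "\<pi> \<in> v_ball 0"
      using uniformizer by (simp add: v_ball_def)
    have "Polynomial.coeff ?P k \<in> O_F" for k
      using O \<pi> by (auto simp: coeff_pCons O_F_eq_v_ball power2_eq_square v_ball_0 v_ball_1
          v_ball_add v_ball_mult_unit v_ball_uminus v_ball_double split: nat.split)
    moreover have "Polynomial.poly (map_poly \<iota> ?P) z = 0"
    proof -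
      have "Polynomial.poly (map_poly \<iota> ?P) z = (\<iota> y)^2 * (\<omega>^2 + \<iota> \<pi>)"
        using emb_add[of 1 1]
        by (simp add: map_poly_pCons emb_zero emb_one emb_add emb_diff emb_uminus emb_mult emb_power xy)
          (simp add: algebra_simps power2_eq_square)
      then show ?thesis
        by (simp add: root)
    qed
    ultimately show "z \<in> O_E"
      unfolding O_E_def by (intro CollectI exI[of _ ?P]) simp
  qed
qed

lemma O_E_units_eq: "O_E_units = {z. z \<noteq> 0 \<and> w z = 0}"
proof -
  have "z \<noteq> 0 \<and> w z = 0" if "z \<in> W.v_ball 0" "u \<in> W.v_ball 0" "z * u = 1" for z u
    using that W.v_mult[of z u] W.v_one by (cases "z = 0 \<or> u = 0") (auto simp: W.v_ball_def)
  moreover have "\<exists>u\<in>W.v_ball 0. z * u = 1" if "z \<noteq> 0" "w z = 0" for z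
    using that by (intro bexI[of _ "inverse z"]) (auto simp: W.v_ball_def W.v_inverse)
  ultimately show ?thesis
    by (auto simp: O_E_units_def O_E_eq W.v_ball_def)
qed

lemma p_E_eq: "p_E = W.v_ball 1"
  by (auto simp: p_E_def O_E_units_eq O_E_eq W.v_ball_def)

lemma p_E_pow_eq: "p_E_pow n = W.v_ball n"
proof (intro equalityI subsetI)
  fix z assume "z \<in> p_E_pow n"
  then obtain \<rho> a where \<rho>: "p_E = (\<lambda>u. \<rho> * u) ` O_E" and a: "a \<in> O_E" "z = \<rho> powi n * a"
    by (auto simp: p_E_pow_def)
  have "\<rho> * 1 \<in> p_E"
    unfolding \<rho> O_E_eq using W.v_ball_1 by (rule imageI)
  \<comment> \<open>Writing \<open>\<omega>\<close> as a multiple of an arbitrary generator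
    \<open>\<rho>\<close> forces \<open>w \<rho> = 1\<close>: the number 1 is the sum of
    \<open>w \<rho>\<close>, which is at least 1, and \<open>w u\<close>, which is at least
    0.\<close>
  moreover obtain u where u: "u \<in> W.v_ball 0" "\<omega> = \<rho> * u"
  proof -
    have "\<omega> \<in> p_E"
      by (simp add: p_E_eq W.v_ball_def w_root)
    then show ?thesis
      using that unfolding \<rho> O_E_eq by auto
  qed
  ultimately have "\<rho> \<noteq> 0" "w \<rho> = 1"
    using root_nonzero w_root W.v_mult[of \<rho> u] by (auto simp: p_E_eq W.v_ball_def)
  then show "z \<in> W.v_ball n"
    using a by (cases "a = 0") (auto simp: W.v_ball_def O_E_eq W.v_mult W.v_power_int)
next
  fix z assume z: "z \<in> W.v_ball n"
  have ball: "\<omega> powi m * a \<in> W.v_ball (m + k)" if "a \<in> W.v_ball k" for m k a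
    using that root_nonzero by (cases "a = 0") (auto simp: W.v_ball_def W.v_mult W.v_power_int w_root)
  have cancel: "\<omega> powi n * (\<omega> powi - n * a) = a" for n a
    using root_nonzero by (simp add: power_int_minus)
  have "p_E = (\<lambda>u. \<omega> * u) ` O_E"
  proof
    show "p_E \<subseteq> (\<lambda>u. \<omega> * u) ` O_E"
    proof
      fix a assume "a \<in> p_E"
      then show "a \<in> (\<lambda>u. \<omega> * u) ` O_E"
        using ball[of a 1 "-1"] cancel[of 1 a]
        by (intro image_eqI[of _ _ "\<omega> powi - 1 * a"]) (auto simp: p_E_eq O_E_eq)
    qed
    show "(\<lambda>u. \<omega> * u) ` O_E \<subseteq> p_E"
      using ball[of _ 0 1] by (auto simp: p_E_eq O_E_eq)
  qed
  moreover have "\<omega> powi - n * z \<in> O_E"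
    using ball[OF z, of "- n"] by (simp add: O_E_eq)
  ultimately show "z \<in> p_E_pow n"
    unfolding p_E_pow_def using cancel[of n z] by (intro CollectI exI[of _ \<omega>] exI[of _ "\<omega> powi - n * z"]) simp
qed

text \<open>Total ramification: for integral \<open>z\<close> the component along
  \<open>\<omega>\<close> lies in \<open>p_E\<close>, so representatives from the base field
  suffice.\<close>

lemma residue_reps_exist: "\<exists>R. W.residue_reps R"
proof -
  obtain R where "residue_reps R"
    using residue_reps_exist ..
  then have R: "R \<subseteq> O_F \<and> finite R \<and> (\<forall>x\<in>O_F. \<exists>!r. r \<in> R \<and> x - r \<in> p_F)"
    unfolding residue_reps_def .
  note R = conjunct1[OF R] conjunct1[OF conjunct2[OF R]] bspec[OF conjunct2[OF conjunct2[OF R]]]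
  have "\<exists>!r. r \<in> \<iota> ` R \<and> z - r \<in> W.v_ball 1" if z: "z \<in> W.v_ball 0" for z
  proof -
    obtain x y where xy: "z = \<iota> x + \<iota> y * \<omega>"
      using decomposition by blast
    have x: "x \<in> O_F" and y: "y = 0 \<or> 1 \<le> 1 + 2 * v y"
      using z unfolding xy W_ball_iff by (auto simp: O_F_def)
    have 1: "z - \<iota> a \<in> W.v_ball 1 \<longleftrightarrow> x - a \<in> p_F" for a
    proof -
      have "z - \<iota> a = \<iota> (x - a) + \<iota> y * \<omega>"
        by (simp add: xy emb_diff)
      moreover have "1 \<le> 2 * k \<longleftrightarrow> 1 \<le> k" for k :: int
        by arith
      ultimately show ?thesis
        using y by (simp only: W_ball_iff p_F_def mem_Collect_eq) blast
    qed
    obtain a where a: "a \<in> R" "x - a \<in> p_F" and uniq: "\<And>c. c \<in> R \<Longrightarrow> x - c \<in> p_F \<Longrightarrow> c = a"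
      using R(3)[OF x] by (elim ex1E conjE) metis
    show ?thesis
    proof (rule ex1I[of _ "\<iota> a"])
      show "\<iota> a \<in> \<iota> ` R \<and> z - \<iota> a \<in> W.v_ball 1"
        using a 1 by simp
      show "r = \<iota> a" if "r \<in> \<iota> ` R \<and> z - r \<in> W.v_ball 1" for r
        using that uniq 1 by blast
    qed
  qed
  moreover have "\<iota> ` R \<subseteq> W.v_ball 0"
  proof
    fix z assume "z \<in> \<iota> ` R"
    then obtain x where "z = \<iota> x" "x \<in> O_F"
      using R(1) by blast
    then show "z \<in> W.v_ball 0"
      by (cases "x = 0") (auto simp: W.v_ball_def O_F_def w_emb emb_zero)
  qed
  ultimately show ?thesis
    using R(2) unfolding W.residue_reps_def W.O_F_eq_v_ball W.p_F_eq_v_ball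
    by (intro exI[of _ "\<iota> ` R"] conjI ballI finite_imageI)
qed

text \<open>In coordinates every term of the norm beyond 1 contains \<open>x\<close> or
  \<open>\<pi>\<close>. Hence a character trivial on principal units stays so after composition with
  the norm.\<close>

lemma Norm_principal_unit: "t \<in> p_E \<Longrightarrow> Norm (1 + t) - 1 \<in> p_F"
proof -
  assume t: "t \<in> p_E"
  obtain x y where xy: "t = \<iota> x + \<iota> y * \<omega>"
    using decomposition by blast
  have x: "x \<in> v_ball 1" and y: "y \<in> v_ball 0"
    using t unfolding p_E_eq xy W_ball_iff by (auto simp: v_ball_def)
  have "1 + t = \<iota> (1 + x) + \<iota> y * \<omega>"
    by (simp add: xy emb_add emb_one)
  then have "Norm (1 + t) - 1 = x + x + x * x + \<pi> * (y * y)"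
    by (simp add: Norm_eq) (simp add: power2_eq_square algebra_simps)
  moreover have "\<pi> \<in> v_ball 1"
    using uniformizer by (simp add: v_ball_def)
  ultimately show ?thesis
    using x y v_ball_pos_imp[OF x]
    by (simp add: p_F_eq_v_ball v_ball_add v_ball_double v_ball_mult_unit)
qed

lemma openin_coset: "openin E_topology {z. z - a \<in> W.v_ball n}"
proof -
  have "z - a \<in> W.v_ball n" if "y - a \<in> W.v_ball n" "z - y \<in> W.v_ball n" for y z
    using W.v_ball_add[OF that] by simp
  then show ?thesis
    by (auto simp: openin_E_topology p_E_pow_eq)
qed

end

section \<open>Integrals and sums over residue systems\<close>

text \<open>The common measure \<open>e\<close> may be infinite. Then either all \<open>c i\<close>
  vanish, or \<open>h\<close> is not integrable and its integral is 0 by convention, in agreement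
  with \<open>enn2real \<infinity> = 0\<close>.\<close>

lemma integral_constant_on_pieces:
  fixes h :: "'a \<Rightarrow> complex"
  assumes I: "finite I" "disjoint_family_on A I" and space: "space M = (\<Union>i\<in>I. A i)"
    and A: "\<And>i. i \<in> I \<Longrightarrow> A i \<in> sets M" "\<And>i. i \<in> I \<Longrightarrow> emeasure M (A i) = e"
    and h: "\<And>i x. i \<in> I \<Longrightarrow> x \<in> A i \<Longrightarrow> h x = c i"
  shows "(LINT x|M. h x) = of_real (enn2real e) * (\<Sum>i\<in>I. c i)"
proof (cases "\<forall>i\<in>I. c i = 0")
  case True
  then have "(LINT x|M. h x) = (LINT x|M. 0)"
    using h by (intro Bochner_Integration.integral_cong) (auto simp: space)
  then show ?thesis
    using True by simp
next
  case False
  then obtain i where i: "i \<in> I" "c i \<noteq> 0" by auto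
  show ?thesis
  proof (cases "e = \<infinity>")
    case True
    have "\<not> integrable M h"
    proof
      assume "integrable M h"
      then have "integrable M (\<lambda>x. indicator (A i) x *\<^sub>R h x)"
        using A(1)[OF i(1)] by (rule integrable_mult_indicator[rotated])
      also have "(\<lambda>x. indicator (A i) x *\<^sub>R h x) = (\<lambda>x. indicator (A i) x *\<^sub>R c i)"
        using h i by (auto simp: fun_eq_iff indicator_def)
      finally have "integrable M (\<lambda>x. norm (indicator (A i) x *\<^sub>R c i))"
        by (rule integrable_norm)
      then have "integrable M (\<lambda>x. indicator (A i) x * norm (c i))"
        by simp
      then have "integrable M (indicator (A i) :: 'a \<Rightarrow> real)"
        using i by simp
      then show False
        using A[OF i(1)] True by (simp add: integrable_indicator_iff sets.Int_space_eq2 sets.sets_into_space)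
    qed
    then show ?thesis
      using True by (simp add: not_integrable_integral_eq)
  next
    case False
    have "has_bochner_integral M (\<lambda>x. indicator (A i) x *\<^sub>R c i) (enn2real e *\<^sub>R c i)" if "i \<in> I" for i
      using has_bochner_integral_scaleR_left[OF has_bochner_integral_real_indicator[of "A i" M], of "c i"]
        A[OF that] False by (simp add: measure_def top.not_eq_extremum)
    then have "has_bochner_integral M (\<lambda>x. \<Sum>i\<in>I. indicator (A i) x *\<^sub>R c i) (\<Sum>i\<in>I. enn2real e *\<^sub>R c i)"
      by (intro has_bochner_integral_sum)
    then have "(LINT x|M. (\<Sum>i\<in>I. indicator (A i) x *\<^sub>R c i)) = (\<Sum>i\<in>I. enn2real e *\<^sub>R c i)"
      by (rule has_bochner_integral_integral_eq)
    moreover have "(LINT x|M. h x) = (LINT x|M. (\<Sum>i\<in>I. indicator (A i) x *\<^sub>R c i))"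
    proof (rule Bochner_Integration.integral_cong[OF refl])
      fix x assume "x \<in> space M"
      then obtain i where i: "i \<in> I" "x \<in> A i"
        using space by auto
      then have "x \<notin> A j" if "j \<in> I - {i}" for j
        using I(2) that by (auto simp: disjoint_family_on_def)
      then have "(\<Sum>j\<in>I - {i}. indicator (A j) x *\<^sub>R c j) = 0"
        by (intro sum.neutral) simp
      then show "h x = (\<Sum>i\<in>I. indicator (A i) x *\<^sub>R c i)"
        unfolding sum.remove[OF I(1) i(1)] using i h by simp
    qed
    ultimately show ?thesis
      by (simp add: scaleR_conv_of_real sum_distrib_left)
  qed
qed

section \<open>Sums over residue classes\<close>

context discretely_valued_field
begin

definition rep :: "'f set \<Rightarrow> 'f \<Rightarrow> 'f" where
  "rep R x = (THE r. r \<in> R \<and> x - r \<in> p_F)"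

lemma rep:
  assumes "residue_reps R" "x \<in> v_ball 0"
  shows "rep R x \<in> R" "x - rep R x \<in> v_ball 1"
proof -
  have "\<exists>!r. r \<in> R \<and> x - r \<in> p_F"
    using assms by (simp add: residue_reps_def O_F_eq_v_ball)
  from theI'[OF this] show "rep R x \<in> R" "x - rep R x \<in> v_ball 1"
    by (auto simp: rep_def p_F_eq_v_ball)
qed

lemma rep_eqI:
  assumes "residue_reps R" "r \<in> R" "x - r \<in> v_ball 1"
  shows "rep R x = r"
proof -
  have "r \<in> v_ball 0"
    using assms by (auto simp: residue_reps_def O_F_eq_v_ball)
  then have x: "x \<in> v_ball 0"
    using v_ball_add[of "x - r" 0 r] v_ball_pos_imp[OF assms(3)] by simp
  have "\<exists>!r. r \<in> R \<and> x - r \<in> p_F"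
    using assms(1) x by (simp add: residue_reps_def O_F_eq_v_ball)
  from the1_equality[OF this] show ?thesis
    using assms by (auto simp: rep_def p_F_eq_v_ball)
qed

lemma residue_reps_subset: "residue_reps R \<Longrightarrow> r \<in> R \<Longrightarrow> r \<in> v_ball 0"
  by (auto simp: residue_reps_def O_F_eq_v_ball)

text \<open>Functions that descend from the valuation ring to the residue field; values outside the
  ring are unconstrained.\<close>

definition residue_function :: "('f \<Rightarrow> complex) \<Rightarrow> bool" where
  "residue_function h \<longleftrightarrow> (\<forall>x\<in>v_ball 0. \<forall>y\<in>v_ball 1. h (x + y) = h x)"

lemma residue_function_eq:
  "residue_function h \<Longrightarrow> x \<in> v_ball 0 \<Longrightarrow> x - y \<in> v_ball 1 \<Longrightarrow> h y = h x"
proof -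
  assume h: "residue_function h" and x: "x \<in> v_ball 0" and "x - y \<in> v_ball 1"
  then have "y - x \<in> v_ball 1"
    by (simp add: v_ball_minus_commute)
  with h x have "h (x + (y - x)) = h x"
    unfolding residue_function_def by blast
  then show ?thesis by simp
qed

text \<open>Translation permutes the residue classes but may move \<open>R\<close> off itself, so
  the bijection passes through \<open>rep\<close>.\<close>

lemma residue_sum_shift:
  assumes R: "residue_reps R" and h: "residue_function h" and x: "x \<in> v_ball 0"
  shows "(\<Sum>b\<in>R. h (b + x)) = (\<Sum>b\<in>R. h b)"
proof (rule sum.reindex_bij_witness[where j = "\<lambda>b. rep R (b + x)" and i = "\<lambda>b. rep R (b - x)"])
  fix b assume b: "b \<in> R"
  then have O: "b + x \<in> v_ball 0" "b - x \<in> v_ball 0"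
    using residue_reps_subset[OF R] x by (auto simp: v_ball_add v_ball_diff)
  note rep = rep[OF R O(1)] rep[OF R O(2)]
  show "rep R (b + x) \<in> R" "rep R (b - x) \<in> R"
    using rep by auto
  show "h (rep R (b + x)) = h (b + x)"
    using residue_function_eq[OF h O(1)] rep by simp
  have "rep R (b + x) - x - b = - (b + x - rep R (b + x))"
    "rep R (b - x) + x - b = - (b - x - rep R (b - x))"
    by simp_all
  then show "rep R (rep R (b + x) - x) = b" "rep R (rep R (b - x) + x) = b"
    using v_ball_uminus[OF rep(2)] v_ball_uminus[OF rep(4)] by (metis rep_eqI[OF R b])+
qed

lemma residue_sum_scale:
  assumes R: "residue_reps R" and h: "residue_function h" and u: "u \<noteq> 0" "v u = 0"
  shows "(\<Sum>a\<in>R - v_ball 1. h (u * a)) = (\<Sum>a\<in>R - v_ball 1. h a)"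
proof (rule sum.reindex_bij_witness[where j = "\<lambda>a. rep R (u * a)" and i = "\<lambda>a. rep R (inverse u * a)"])
  have ball: "u * y \<in> v_ball n \<longleftrightarrow> y \<in> v_ball n" "inverse u * y \<in> v_ball n \<longleftrightarrow> y \<in> v_ball n" for y n
    using u by (cases "y = 0"; auto simp: v_ball_def v_mult v_inverse)+
  fix a assume a: "a \<in> R - v_ball 1"
  then have O: "u * a \<in> v_ball 0" "inverse u * a \<in> v_ball 0"
    using residue_reps_subset[OF R] by (auto simp: ball)
  note rep = rep[OF R O(1)] rep[OF R O(2)]
  show "rep R (u * a) \<in> R - v_ball 1" "rep R (inverse u * a) \<in> R - v_ball 1"
    using rep v_ball_add[OF rep(2), of "rep R (u * a)"]
      v_ball_add[OF rep(4), of "rep R (inverse u * a)"] a by (auto simp: ball)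
  show "h (rep R (u * a)) = h (u * a)"
    using residue_function_eq[OF h O(1)] rep by simp
  have "inverse u * rep R (u * a) - a = inverse u * (rep R (u * a) - u * a)"
    "u * rep R (inverse u * a) - a = u * (rep R (inverse u * a) - inverse u * a)"
    using u by (simp_all add: algebra_simps)
  moreover have "rep R (u * a) - u * a \<in> v_ball 1" "rep R (inverse u * a) - inverse u * a \<in> v_ball 1"
    using rep(2,4) unfolding v_ball_minus_commute[of _ "rep R _"] .
  ultimately have "inverse u * rep R (u * a) - a \<in> v_ball 1" "u * rep R (inverse u * a) - a \<in> v_ball 1"
    by (simp_all only: ball)
  then show "rep R (inverse u * rep R (u * a)) = a" "rep R (u * rep R (inverse u * a)) = a"
    using a by (metis DiffD1 rep_eqI[OF R])+
qed

lemma residue_reps_p: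
  assumes "residue_reps R"
  shows "\<exists>r. R \<inter> v_ball 1 = {r}"
proof -
  have "r = rep R 0" if "r \<in> R" "r \<in> v_ball 1" for r
    using rep_eqI[OF assms that(1), of 0] v_ball_uminus[OF that(2)] by simp
  moreover have "rep R 0 \<in> R" "rep R 0 \<in> v_ball 1"
    using rep[OF assms v_ball_0] v_ball_uminus[of "- rep R 0" 1] by simp_all
  ultimately have "R \<inter> v_ball 1 = {rep R 0}"
    by blast
  then show ?thesis ..
qed

text \<open>Writing \<open>a / (1 + a * b) = 1 / (b + 1 / a)\<close>, the terms with \<open>a\<close> a unit are \<open>\<theta> a\<close> times a
  function of \<open>b + 1 / a\<close>. Summing over \<open>b\<close> leaves a multiple of the sum of the nontrivial
  character \<open>\<theta>\<close>, so that only the residue class of \<open>a = 0\<close> contributes.\<close>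

lemma twisted_residue_sum:
  fixes \<theta> \<psi> :: "'f \<Rightarrow> complex"
  assumes R: "residue_reps R"
    and \<theta>_mult: "\<And>x y. x \<noteq> 0 \<Longrightarrow> y \<noteq> 0 \<Longrightarrow> \<theta> (x * y) = \<theta> x * \<theta> y"
    and \<theta>_one: "\<And>x. x \<in> v_ball 1 \<Longrightarrow> \<theta> (1 + x) = 1"
    and nontrivial: "u \<noteq> 0" "v u = 0" "\<theta> u \<noteq> 1"
    and \<psi>: "residue_function \<psi>"
    and unit: "\<And>a b. a \<in> v_ball 0 \<Longrightarrow> b \<in> v_ball 0 \<Longrightarrow> 1 + a * b \<notin> v_ball 1 \<Longrightarrow>
      \<phi> a b = \<theta> (1 + a * b) * \<psi> (a / (1 + a * b))"
    and nonunit: "\<And>a b. a \<in> v_ball 0 \<Longrightarrow> b \<in> v_ball 0 \<Longrightarrow> 1 + a * b \<in> v_ball 1 \<Longrightarrow>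
      \<phi> a b = \<theta> a * \<kappa>"
  shows "(\<Sum>b\<in>R. \<Sum>a\<in>R. \<phi> a b) = of_nat (card R) * \<psi> 0"
proof -
  \<comment> \<open>For a unit \<open>a\<close> and \<open>x = b + 1 / a\<close> one has
    \<open>1 + a * b = a * x\<close>, so both hypotheses on \<open>\<phi>\<close> turn into
    \<open>\<phi> a b = \<theta> a * H x\<close>; the constant \<open>\<kappa>\<close> becomes the
    value at the zero class.\<close>
  define H where "H x = (if x \<in> v_ball 1 then \<kappa> else \<theta> x * \<psi> (1 / x))" for x
  have fin: "finite R"
    using R by (simp add: residue_reps_def)
  have unit_add: "x + y \<noteq> 0" "v (x + y) = 0" "\<theta> (x + y) = \<theta> x"
    if "x \<noteq> 0" "v x = 0" "y \<in> v_ball 1" for x y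
  proof -
    have yx: "y / x \<in> v_ball 1"
      using that by (cases "y = 0") (auto simp: v_ball_def v_divide)
    have *: "x + y = x * (1 + y / x)"
      using that by (simp add: field_simps)
    show "x + y \<noteq> 0" "v (x + y) = 0"
      unfolding * using v_ball_one_add[OF yx] that by (auto simp: v_mult)
    show "\<theta> (x + y) = \<theta> x"
      unfolding * using v_ball_one_add[OF yx] that \<theta>_one[OF yx] \<theta>_mult by simp
  qed
  have H: "residue_function H"
    unfolding residue_function_def
  proof (intro ballI)
    fix x y assume x: "x \<in> v_ball 0" and y: "y \<in> v_ball 1"
    show "H (x + y) = H x"
    proof (cases "x \<in> v_ball 1")
      case True
      then show ?thesis
        using y by (simp add: H_def v_ball_add)
    next
      case False
      then have x0: "x \<noteq> 0" "v x = 0"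
        using v_unit_iff[OF x] by auto
      note xy = unit_add[OF x0 y]
      have "1 / x - 1 / (x + y) = y / (x * (x + y))"
        using x0 xy by (simp add: field_simps)
      then have "1 / x - 1 / (x + y) \<in> v_ball 1"
        using x0 xy y by (cases "y = 0") (auto simp: v_ball_def v_divide v_mult)
      then have "\<psi> (1 / (x + y)) = \<psi> (1 / x)"
        using x0 by (intro residue_function_eq[OF \<psi>]) (auto simp: v_ball_def v_divide v_one)
      moreover have "x + y \<notin> v_ball 1"
        using xy by (simp add: v_ball_def)
      ultimately show ?thesis
        using False xy by (simp add: H_def)
    qed
  qed
  have row_unit: "(\<Sum>b\<in>R. \<phi> a b) = \<theta> a * (\<Sum>b\<in>R. H b)" if a: "a \<in> R - v_ball 1" for a
  proof -
    have aO: "a \<in> v_ball 0"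
      using a residue_reps_subset[OF R] by auto
    then have a0: "a \<noteq> 0" "v a = 0"
      using v_unit_iff[of a] a by auto
    have "\<phi> a b = \<theta> a * H (b + 1 / a)" if b: "b \<in> R" for b
    proof -
      have bO: "b \<in> v_ball 0"
        using b residue_reps_subset[OF R] by auto
      have eq: "1 + a * b = a * (b + 1 / a)"
        using a0 by (simp add: field_simps)
      then have ball: "1 + a * b \<in> v_ball 1 \<longleftrightarrow> b + 1 / a \<in> v_ball 1"
        using a0 by (cases "b + 1 / a = 0") (auto simp: v_ball_def v_mult)
      show ?thesis
      proof (cases "1 + a * b \<in> v_ball 1")
        case True
        then show ?thesis
          using nonunit[OF aO bO] ball by (simp add: H_def)
      next
        case False
        then have nz: "b + 1 / a \<noteq> 0"
          using ball v_ball_0[of 1] by auto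
        have "a / (1 + a * b) = 1 / (b + 1 / a)"
          unfolding eq using a0 by simp
        then show ?thesis
          using unit[OF aO bO False] False ball \<theta>_mult[OF a0(1) nz] unfolding eq by (simp add: H_def)
      qed
    qed
    then have "(\<Sum>b\<in>R. \<phi> a b) = \<theta> a * (\<Sum>b\<in>R. H (b + 1 / a))"
      by (simp add: sum_distrib_left)
    also have "(\<Sum>b\<in>R. H (b + 1 / a)) = (\<Sum>b\<in>R. H b)"
      using a0 by (intro residue_sum_shift[OF R H]) (auto simp: v_ball_def v_divide v_one)
    finally show ?thesis .
  qed
  \<comment> \<open>Extension by 0 turns the character into a residue function. Scaling by
    \<open>u\<close> multiplies its sum by \<open>\<theta> u\<close>, which is not 1, so the sum
    vanishes.\<close>
  define \<theta>' where "\<theta>' x = (if x \<in> v_ball 1 then 0 else \<theta> x)" for x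
  have "residue_function \<theta>'"
    unfolding residue_function_def
  proof (intro ballI)
    fix x y assume x: "x \<in> v_ball 0" and y: "y \<in> v_ball 1"
    show "\<theta>' (x + y) = \<theta>' x"
    proof (cases "x \<in> v_ball 1")
      case True
      then show ?thesis
        using y by (simp add: \<theta>'_def v_ball_add)
    next
      case False
      then have "x \<noteq> 0" "v x = 0"
        using v_unit_iff[OF x] by auto
      from unit_add[OF this y] show ?thesis
        using False by (auto simp: \<theta>'_def v_ball_def)
    qed
  qed
  then have "(\<Sum>a\<in>R - v_ball 1. \<theta>' (u * a)) = (\<Sum>a\<in>R - v_ball 1. \<theta>' a)"
    by (rule residue_sum_scale[OF R _ nontrivial(1,2)])
  moreover have "(\<Sum>a\<in>R - v_ball 1. \<theta>' (u * a)) = (\<Sum>a\<in>R - v_ball 1. \<theta> u * \<theta> a)"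
    "(\<Sum>a\<in>R - v_ball 1. \<theta>' a) = (\<Sum>a\<in>R - v_ball 1. \<theta> a)"
  proof -
    have "\<theta>' (u * a) = \<theta> u * \<theta> a" "\<theta>' a = \<theta> a" if "a \<in> R - v_ball 1" for a
      using that nontrivial v_ball_0[of 1] \<theta>_mult[of u a] by (auto simp: \<theta>'_def v_ball_def v_mult)
    then show "(\<Sum>a\<in>R - v_ball 1. \<theta>' (u * a)) = (\<Sum>a\<in>R - v_ball 1. \<theta> u * \<theta> a)"
      "(\<Sum>a\<in>R - v_ball 1. \<theta>' a) = (\<Sum>a\<in>R - v_ball 1. \<theta> a)"
      by (auto intro: sum.cong)
  qed
  ultimately have "\<theta> u * (\<Sum>a\<in>R - v_ball 1. \<theta> a) = (\<Sum>a\<in>R - v_ball 1. \<theta> a)"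
    by (simp add: sum_distrib_left)
  then have char_sum: "(\<Sum>a\<in>R - v_ball 1. \<theta> a) = 0"
    using nontrivial(3) by (simp add: mult_cancel_right1)
  have row_0: "(\<Sum>b\<in>R. \<phi> a b) = of_nat (card R) * \<psi> 0" if a: "a \<in> v_ball 1" for a
  proof -
    have "\<phi> a b = \<psi> 0" if b: "b \<in> R" for b
    proof -
      have bO: "b \<in> v_ball 0"
        using b residue_reps_subset[OF R] by auto
      then have ab: "a * b \<in> v_ball 1"
        using a by (simp add: v_ball_mult_unit)
      note 1 = v_ball_one_add[OF ab]
      have "a / (1 + a * b) \<in> v_ball 1"
        using a 1 by (cases "a = 0") (auto simp: v_ball_def v_divide)
      then have "\<psi> (0 + a / (1 + a * b)) = \<psi> 0"
        using \<psi> v_ball_0 unfolding residue_function_def by blast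
      moreover have "1 + a * b \<notin> v_ball 1"
        using 1 by (simp add: v_ball_def)
      ultimately show ?thesis
        using unit[OF v_ball_pos_imp[OF a] bO] \<theta>_one[OF ab] by simp
    qed
    then show ?thesis by simp
  qed
  obtain r where r: "R \<inter> v_ball 1 = {r}"
    using residue_reps_p[OF R] by blast
  \<comment> \<open>The substitution \<open>b + 1 / a\<close> works for fixed \<open>a\<close>, so
    the sum over \<open>b\<close> has to become the inner one.\<close>
  have "(\<Sum>b\<in>R. \<Sum>a\<in>R. \<phi> a b) = (\<Sum>a\<in>R. \<Sum>b\<in>R. \<phi> a b)"
    by (rule sum.swap)
  also have "\<dots> = (\<Sum>a\<in>R - v_ball 1. \<Sum>b\<in>R. \<phi> a b) + (\<Sum>a\<in>R \<inter> v_ball 1. \<Sum>b\<in>R. \<phi> a b)"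
    using sum.Int_Diff[OF fin, of _ "v_ball 1"] by (simp add: add.commute)
  also have "\<dots> = (\<Sum>a\<in>R - v_ball 1. \<theta> a) * (\<Sum>b\<in>R. H b) + (\<Sum>b\<in>R. \<phi> r b)"
    using row_unit by (simp add: r sum_distrib_right)
  also have "\<dots> = of_nat (card R) * \<psi> 0"
    using row_0[of r] r by (auto simp: char_sum)
  finally show ?thesis .
qed

end

section \<open>Subgroups of the group attached to the chambers\<close>

text \<open>For \<open>s = False\<close> the two basis vectors are interchanged: this symmetry exchanges the two
  chambers adjacent to a wall.\<close>

definition mat2 :: "bool \<Rightarrow> 'a::zero \<Rightarrow> 'a \<Rightarrow> 'a \<Rightarrow> 'a \<Rightarrow> 'a^2^2" where
  "mat2 s a b c d = (if s then vector [vector [a, b], vector [c, d]] else vector [vector [d, c], vector [b, a]])"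

lemma mat2_nth:
  "mat2 s a b c d $ 1 $ 1 = (if s then a else d)" "mat2 s a b c d $ 1 $ 2 = (if s then b else c)"
  "mat2 s a b c d $ 2 $ 1 = (if s then c else b)" "mat2 s a b c d $ 2 $ 2 = (if s then d else a)"
  by (simp_all add: mat2_def)

lemma mat2_mult:
  fixes a :: "'a::comm_ring_1"
  shows "mat2 s a b c d ** mat2 s a' b' c' d' =
    mat2 s (a * a' + b * c') (a * b' + b * d') (c * a' + d * c') (c * b' + d * d')"
  by (cases s) (simp_all add: vec_eq_iff forall_2 matrix_matrix_mult_def sum_2 mat2_nth add.commute)

lemma det_mat2: "Determinants.det (mat2 s a b c d) = a * d - b * (c :: 'a::comm_ring_1)"
  by (cases s) (simp_all add: det_2 mat2_nth algebra_simps)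

lemma mat2_one: "mat2 s 1 0 0 1 = mat 1"
  by (cases s) (simp_all add: vec_eq_iff forall_2 mat2_nth mat_def)

lemma mat2_swap: "mat2 (\<not> s) a b c d = mat2 s d c b a"
  by (simp add: mat2_def)

lemma mat2_exhaust:
  obtains a b c d where "M = mat2 s a b c d"
proof -
  have "M = mat2 s (if s then M$1$1 else M$2$2) (if s then M$1$2 else M$2$1)
      (if s then M$2$1 else M$1$2) (if s then M$2$2 else M$1$1)"
    by (simp add: vec_eq_iff forall_2 mat2_nth)
  then show ?thesis
    by (rule that)
qed

context counterexample_setting
begin

text \<open>A factorisation into linear factors exhibits a root unless it has no factor at all,
  which the coefficient of X^2 excludes.\<close>

lemma square_root_exists: "\<exists>\<omega>. \<omega> ^ 2 = - \<iota>2 \<pi>_F"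
proof -
  obtain c rs where P: "map_poly \<iota>2 [:\<pi>_F, 0, 1:] = Polynomial.smult c (\<Prod>r\<leftarrow>rs. [:- r, 1:])"
    using E2_splitting by (auto simp: is_splitting_field_def)
  have P': "map_poly \<iota>2 [:\<pi>_F, 0, 1:] = [:\<iota>2 \<pi>_F, 0, 1:]"
    by (simp add: map_poly_pCons E2.emb_zero E2.emb_one)
  show ?thesis
  proof (cases rs)
    case Nil
    then have "Polynomial.coeff [:\<iota>2 \<pi>_F, 0, 1:] 2 = Polynomial.coeff [:c:] 2"
      using P unfolding P' by simp
    then show ?thesis
      by (simp add: numeral_2_eq_2)
  next
    case (Cons r rs')
    then have "Polynomial.poly [:\<iota>2 \<pi>_F, 0, 1:] r = 0"
      using P unfolding P' by simp
    then show ?thesis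
      by (intro exI[of _ r]) (simp add: power2_eq_square eq_neg_iff_add_eq_0 add.commute)
  qed
qed

definition \<omega>2 :: 'e2 where "\<omega>2 = (SOME \<omega>. \<omega> ^ 2 = - \<iota>2 \<pi>_F)"

sublocale Q: ramified_quadratic_ext v \<iota>2 b2 \<pi>_F \<omega>2
  using uniformizer someI_ex[OF square_root_exists] by unfold_locales (auto simp: \<omega>2_def)

abbreviation ball2 :: "int \<Rightarrow> 'e2 set" where "ball2 n \<equiv> Q.W.v_ball n"

lemma \<omega>2_power_mult_ball: "\<omega>2 powi n * y \<in> ball2 m \<longleftrightarrow> y \<in> ball2 (m - n)"
  using Q.root_nonzero by (cases "y = 0") (auto simp: Q.W.v_ball_def Q.W.v_mult Q.W.v_power_int Q.w_root)

lemma G0_mult: "(A, x) \<otimes>\<^bsub>G0\<^esub> (B, y) = (A ** B, x * y)"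
  by (simp add: G0_def)

lemma G0_carrier_iff:
  "(A, x) \<in> carrier G0 \<longleftrightarrow>
    Determinants.det A \<noteq> 0 \<and> x \<noteq> 0 \<and> E2.Norm (Determinants.det A) * E4.Norm x = 1"
  by (simp add: G0_def)

lemma G0_closed: "g \<in> carrier G0 \<Longrightarrow> h \<in> carrier G0 \<Longrightarrow> g \<otimes>\<^bsub>G0\<^esub> h \<in> carrier G0"
  by (cases g; cases h) (simp add: G0_mult G0_carrier_iff det_mul E2.Norm_mult E4.Norm_mult algebra_simps)

lemma G0_assoc: "(g \<otimes>\<^bsub>G0\<^esub> h) \<otimes>\<^bsub>G0\<^esub> k = g \<otimes>\<^bsub>G0\<^esub> (h \<otimes>\<^bsub>G0\<^esub> k)"
  by (cases g; cases h; cases k) (simp add: G0_mult matrix_mul_assoc mult.assoc)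

lemma G0_left_one: "(mat 1, 1) \<otimes>\<^bsub>G0\<^esub> g = g" and G0_right_one: "g \<otimes>\<^bsub>G0\<^esub> (mat 1, 1) = g"
  by (cases g; simp add: G0_mult matrix_mul_lid matrix_mul_rid)+

lemma SL2_in_G0: "Determinants.det A = 1 \<Longrightarrow> (A, 1) \<in> carrier G0"
  by (simp add: G0_carrier_iff E2.Norm_one E4.Norm_one)

text \<open>\<open>Kpl True n\<close> belongs to chamber \<open>- n\<close> and \<open>Kpl False n\<close> to chamber \<open>n - 1\<close>, so that \<open>Kpl s n\<close>
  and \<open>Kpl s (n + 1)\<close> are always adjacent.\<close>

definition Kpl :: "bool \<Rightarrow> int \<Rightarrow> (('e2^2^2) \<times> 'e4) set" where
  "Kpl s n = {(g2, g4) \<in> carrier G0. \<exists>a b c d. g2 = mat2 s a b c d \<and> a - 1 \<in> ball2 1 \<and>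
    d - 1 \<in> ball2 1 \<and> b \<in> ball2 n \<and> c \<in> ball2 (1 - n) \<and> g4 - 1 \<in> E4.p_E}"

lemma mat2_eq_iff: "mat2 s a b c d = mat2 s a' b' c' d' \<longleftrightarrow> a = a' \<and> b = b' \<and> c = c' \<and> d = d'"
  by (cases s) (auto simp: vec_eq_iff forall_2 mat2_nth)

lemma Kpl_iff:
  "(mat2 s a b c d, z) \<in> Kpl s n \<longleftrightarrow> (mat2 s a b c d, z) \<in> carrier G0 \<and> a - 1 \<in> ball2 1 \<and>
    d - 1 \<in> ball2 1 \<and> b \<in> ball2 n \<and> c \<in> ball2 (1 - n) \<and> z - 1 \<in> E4.p_E"
  unfolding Kpl_def by (auto simp: mat2_eq_iff)

lemma Kpl_exhaust:
  assumes "k \<in> Kpl s n"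
  obtains a b c d z where "k = (mat2 s a b c d, z)"
  using assms by (auto simp: Kpl_def)

lemma Kpl_carrier: "k \<in> Kpl s n \<Longrightarrow> k \<in> carrier G0"
  by (auto simp: Kpl_def)

lemma Kpl_swap: "Kpl (\<not> s) n = Kpl s (1 - n)"
proof -
  have "(mat2 s d c b a, z) \<in> Kpl (\<not> s) n \<longleftrightarrow> (mat2 s d c b a, z) \<in> Kpl s (1 - n)" for a b c d z
    using Kpl_iff[of "\<not> s" a b c d z n] unfolding mat2_swap Kpl_iff by auto
  then have "g \<in> Kpl (\<not> s) n \<longleftrightarrow> g \<in> Kpl s (1 - n)" for g
    by (metis mat2_exhaust surj_pair)
  then show ?thesis by blast
qed

lemma K_plus_eq_Kpl: "K_plus i = Kpl True (- i)"
proof -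
  have "(mat2 True a b c d, z) \<in> K_plus i \<longleftrightarrow> (mat2 True a b c d, z) \<in> Kpl True (- i)" for a b c d z
    by (auto simp: K_plus_def Kpl_iff mat2_nth Q.p_E_eq Q.p_E_pow_eq add.commute)
  then have "g \<in> K_plus i \<longleftrightarrow> g \<in> Kpl True (- i)" for g
    by (metis mat2_exhaust surj_pair)
  then show ?thesis by blast
qed

lemma one_minus_one_p4: "1 - 1 \<in> E4.p_E"
  using E4.emb_p_E_iff[of 0] by (simp add: E4.emb_zero E2.p_F_def)

definition unip :: "bool \<Rightarrow> 'e2 \<Rightarrow> ('e2^2^2) \<times> 'e4" where "unip s x = (mat2 s 1 x 0 1, 1)"

definition tor :: "bool \<Rightarrow> 'e2 \<Rightarrow> ('e2^2^2) \<times> 'e4" where "tor s t = (mat2 s t 0 0 (inverse t), 1)"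

lemma unip_in_G0: "unip s x \<in> carrier G0"
  by (simp add: unip_def SL2_in_G0 det_mat2)

lemma unip_in_Kpl: "x \<in> ball2 n \<Longrightarrow> unip s x \<in> Kpl s n"
  using unip_in_G0[of s x] one_minus_one_p4 unfolding unip_def Kpl_iff by (simp add: Q.W.v_ball_0)

lemma unip_add: "unip s x \<otimes>\<^bsub>G0\<^esub> unip s y = unip s (x + y)"
  by (simp add: unip_def G0_mult mat2_mult add.commute)

lemma unip_0: "unip s 0 = (mat 1, 1)"
  by (simp add: unip_def mat2_one)

text \<open>Belongs to the wall: it is normal in the groups of both adjacent chambers, with quotient
  the additive group of the residue field. The integrals on both sides of the wall are cut along its
  cosets.\<close>

definition Kmeet :: "bool \<Rightarrow> int \<Rightarrow> (('e2^2^2) \<times> 'e4) set" where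
  "Kmeet s n = Kpl s n \<inter> Kpl s (n + 1)"

lemma Kmeet_iff:
  "(mat2 s a b c d, z) \<in> Kmeet s n \<longleftrightarrow> (mat2 s a b c d, z) \<in> carrier G0 \<and> a - 1 \<in> ball2 1 \<and>
    d - 1 \<in> ball2 1 \<and> b \<in> ball2 (n + 1) \<and> c \<in> ball2 (1 - n) \<and> z - 1 \<in> E4.p_E"
  unfolding Kmeet_def using Q.W.v_ball_antimono[of n "n + 1" b] Q.W.v_ball_antimono[of "- n" "1 - n" c]
  by (auto simp: Kpl_iff)

lemma Kmeet_swap: "Kmeet (\<not> s) (- n) = Kmeet s n"
  unfolding Kmeet_def Kpl_swap by (auto simp: add.commute)

definition upper :: "bool \<Rightarrow> ('e2^2^2) \<times> 'e4 \<Rightarrow> 'e2" where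
  "upper s g = (if s then fst g $ 1 $ 2 else fst g $ 2 $ 1)"

lemma upper_mat2: "upper s (mat2 s a b c d, z) = b"
  by (simp add: upper_def mat2_nth)

text \<open>A coset of \<open>Kmeet s n\<close>, described by a congruence on one entry; the
  congruence is an open condition, which settles measurability.\<close>

definition piece :: "bool \<Rightarrow> int \<Rightarrow> 'e2 \<Rightarrow> (('e2^2^2) \<times> 'e4) set" where
  "piece s n x = {k \<in> Kpl s n. upper s k - x \<in> ball2 (n + 1)}"

text \<open>Translating back by \<open>unip s (- x)\<close> works because \<open>(a - 1) * x\<close>
  gains one power of the prime and \<open>c * x\<close> lies in the prime ideal. Cosets of this side
  match the left invariance of an integrand.\<close>

lemma piece_eq_right_coset:
  assumes x: "x \<in> ball2 n"
  shows "piece s n x = (\<lambda>d. d \<otimes>\<^bsub>G0\<^esub> unip s x) ` Kmeet s n"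
proof (intro equalityI subsetI)
  fix k assume k: "k \<in> piece s n x"
  then have K: "k \<in> Kpl s n"
    by (simp add: piece_def)
  from Kpl_exhaust[OF this] obtain a b c d z where abcd: "k = (mat2 s a b c d, z)" .
  have *: "a - 1 \<in> ball2 1" "d - 1 \<in> ball2 1" "c \<in> ball2 (1 - n)" "z - 1 \<in> E4.p_E"
    "b - x \<in> ball2 (n + 1)"
    using k by (auto simp: piece_def abcd Kpl_iff upper_mat2)
  have "c * x \<in> ball2 1"
    by (rule Q.W.v_ball_mult[OF *(3) x]) simp
  then have d: "d - c * x - 1 \<in> ball2 1"
    using Q.W.v_ball_diff[OF *(2), of "c * x"] by (simp add: algebra_simps)
  have "(a - 1) * x \<in> ball2 (n + 1)"
    by (rule Q.W.v_ball_mult[OF *(1) x]) simp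
  then have b: "b - a * x \<in> ball2 (n + 1)"
    using Q.W.v_ball_diff[OF *(5), of "(a - 1) * x"] by (simp add: algebra_simps)
  have e: "k \<otimes>\<^bsub>G0\<^esub> unip s (- x) = (mat2 s a (b - a * x) c (d - c * x), z)"
    by (simp add: abcd unip_def G0_mult mat2_mult)
  have "k \<otimes>\<^bsub>G0\<^esub> unip s (- x) \<in> Kmeet s n"
    using G0_closed[OF Kpl_carrier[OF K] unip_in_G0[of s "- x"]] b d * unfolding e Kmeet_iff by simp
  moreover have "k = (k \<otimes>\<^bsub>G0\<^esub> unip s (- x)) \<otimes>\<^bsub>G0\<^esub> unip s x"
    by (simp add: G0_assoc unip_add unip_0 G0_right_one)
  ultimately show "k \<in> (\<lambda>d. d \<otimes>\<^bsub>G0\<^esub> unip s x) ` Kmeet s n"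
    by (rule rev_image_eqI)
next
  fix k assume "k \<in> (\<lambda>d. d \<otimes>\<^bsub>G0\<^esub> unip s x) ` Kmeet s n"
  then obtain e where e: "e \<in> Kmeet s n" "k = e \<otimes>\<^bsub>G0\<^esub> unip s x" by blast
  have E: "e \<in> Kpl s n"
    using e by (simp add: Kmeet_def)
  from Kpl_exhaust[OF this] obtain a b c d z where abcd: "e = (mat2 s a b c d, z)" .
  have *: "a - 1 \<in> ball2 1" "d - 1 \<in> ball2 1" "c \<in> ball2 (1 - n)" "z - 1 \<in> E4.p_E"
    "b \<in> ball2 (n + 1)"
    using e(1) unfolding abcd Kmeet_iff by auto
  have k: "k = (mat2 s a (a * x + b) c (c * x + d), z)"
    by (simp add: e abcd unip_def G0_mult mat2_mult)
  have "c * x \<in> ball2 1"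
    by (rule Q.W.v_ball_mult[OF *(3) x]) simp
  then have d: "c * x + d - 1 \<in> ball2 1"
    using Q.W.v_ball_add[OF _ *(2), of "c * x"] by (simp add: algebra_simps)
  have "(a - 1) * x \<in> ball2 (n + 1)"
    by (rule Q.W.v_ball_mult[OF *(1) x]) simp
  then have b: "a * x + b - x \<in> ball2 (n + 1)"
    using Q.W.v_ball_add[OF _ *(5), of "(a - 1) * x"] by (simp add: algebra_simps)
  then have "a * x + b \<in> ball2 n"
    using Q.W.v_ball_add[OF Q.W.v_ball_antimono[OF _ b] x] by simp
  then show "k \<in> piece s n x"
    using G0_closed[OF Kpl_carrier[OF E] unip_in_G0[of s x]] b d *
    unfolding piece_def e(2)[symmetric] unfolding k by (simp add: Kpl_iff upper_mat2)
qed

text \<open>Left invariance of Haar measure calls for cosets of this side. Together the two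
  descriptions express that \<open>Kmeet s n\<close> is normalised by the unipotents of
  \<open>Kpl s n\<close>.\<close>

lemma piece_eq_left_coset:
  assumes x: "x \<in> ball2 n"
  shows "piece s n x = (\<lambda>d. unip s x \<otimes>\<^bsub>G0\<^esub> d) ` Kmeet s n"
proof (intro equalityI subsetI)
  fix k assume k: "k \<in> piece s n x"
  then have K: "k \<in> Kpl s n"
    by (simp add: piece_def)
  from Kpl_exhaust[OF this] obtain a b c d z where abcd: "k = (mat2 s a b c d, z)" .
  have *: "a - 1 \<in> ball2 1" "d - 1 \<in> ball2 1" "c \<in> ball2 (1 - n)" "z - 1 \<in> E4.p_E"
    "b - x \<in> ball2 (n + 1)"
    using k by (auto simp: piece_def abcd Kpl_iff upper_mat2)
  have "x * c \<in> ball2 1"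
    by (rule Q.W.v_ball_mult[OF x *(3)]) simp
  then have a: "a - x * c - 1 \<in> ball2 1"
    using Q.W.v_ball_diff[OF *(1), of "x * c"] by (simp add: algebra_simps)
  have "x * (d - 1) \<in> ball2 (n + 1)"
    by (rule Q.W.v_ball_mult[OF x *(2)]) simp
  then have b: "b - x * d \<in> ball2 (n + 1)"
    using Q.W.v_ball_diff[OF *(5), of "x * (d - 1)"] by (simp add: algebra_simps)
  have e: "unip s (- x) \<otimes>\<^bsub>G0\<^esub> k = (mat2 s (a - x * c) (b - x * d) c d, z)"
    by (simp add: abcd unip_def G0_mult mat2_mult)
  have "unip s (- x) \<otimes>\<^bsub>G0\<^esub> k \<in> Kmeet s n"
    using G0_closed[OF unip_in_G0[of s "- x"] Kpl_carrier[OF K]] a b * unfolding e Kmeet_iff by simp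
  moreover have "k = unip s x \<otimes>\<^bsub>G0\<^esub> (unip s (- x) \<otimes>\<^bsub>G0\<^esub> k)"
    by (simp add: unip_add unip_0 G0_left_one flip: G0_assoc)
  ultimately show "k \<in> (\<lambda>d. unip s x \<otimes>\<^bsub>G0\<^esub> d) ` Kmeet s n"
    by (rule rev_image_eqI)
next
  fix k assume "k \<in> (\<lambda>d. unip s x \<otimes>\<^bsub>G0\<^esub> d) ` Kmeet s n"
  then obtain e where e: "e \<in> Kmeet s n" "k = unip s x \<otimes>\<^bsub>G0\<^esub> e" by blast
  have E: "e \<in> Kpl s n"
    using e by (simp add: Kmeet_def)
  from Kpl_exhaust[OF this] obtain a b c d z where abcd: "e = (mat2 s a b c d, z)" .
  have *: "a - 1 \<in> ball2 1" "d - 1 \<in> ball2 1" "c \<in> ball2 (1 - n)" "z - 1 \<in> E4.p_E"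
    "b \<in> ball2 (n + 1)"
    using e(1) unfolding abcd Kmeet_iff by auto
  have k: "k = (mat2 s (a + x * c) (b + x * d) c d, z)"
    by (simp add: e abcd unip_def G0_mult mat2_mult)
  have "x * c \<in> ball2 1"
    by (rule Q.W.v_ball_mult[OF x *(3)]) simp
  then have a: "a + x * c - 1 \<in> ball2 1"
    using Q.W.v_ball_add[OF *(1), of "x * c"] by (simp add: algebra_simps)
  have "x * (d - 1) \<in> ball2 (n + 1)"
    by (rule Q.W.v_ball_mult[OF x *(2)]) simp
  then have b: "b + x * d - x \<in> ball2 (n + 1)"
    using Q.W.v_ball_add[OF *(5), of "x * (d - 1)"] by (simp add: algebra_simps)
  then have "b + x * d \<in> ball2 n"
    using Q.W.v_ball_add[OF Q.W.v_ball_antimono[OF _ b] x] by simp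
  then show "k \<in> piece s n x"
    using G0_closed[OF unip_in_G0[of s x] Kpl_carrier[OF E]] a b *
    unfolding piece_def e(2)[symmetric] unfolding k by (simp add: Kpl_iff upper_mat2)
qed

section \<open>Topology and integration on the chamber groups\<close>

lemma openin_entry:
  assumes "openin E2.E_topology V"
  shows "openin G0_topology {g \<in> carrier G0. fst g $ i $ j \<in> V}"
proof -
  let ?T = "pullback_topology UNIV (\<lambda>g (i, j). g $ i $ j) (product_topology (\<lambda>_ :: 2 \<times> 2. E2.E_topology) UNIV)"
  have "continuous_map ?T E2.E_topology ((\<lambda>x. x (i, j)) \<circ> (\<lambda>g (i, j). g $ i $ j))"
    by (intro continuous_map_pullback continuous_map_product_projection) simp
  then have "continuous_map (prod_topology ?T E4.E_topology) E2.E_topology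
      ((\<lambda>x. x (i, j)) \<circ> (\<lambda>g (i, j). g $ i $ j) \<circ> fst)"
    using continuous_map_compose continuous_map_fst by blast
  then have "continuous_map G0_topology E2.E_topology (\<lambda>g. fst g $ i $ j)"
    unfolding G0_topology_def by (intro continuous_map_from_subtopology) (simp add: comp_def)
  from openin_continuous_map_preimage[OF this assms] show ?thesis
    by (simp add: G0_topology_def topspace_pullback_topology E2.topspace_E_topology
        E4.topspace_E_topology PiE_def)
qed

lemma topspace_G0_topology: "topspace G0_topology = carrier G0"
  by (simp add: G0_topology_def topspace_pullback_topology E2.topspace_E_topology
      E4.topspace_E_topology PiE_def)

lemma openin_piece: "openin (subtopology G0_topology (Kpl s n)) (piece s n x)"
proof -
  have "piece s n x = {g \<in> carrier G0. upper s g \<in> {z. z - x \<in> ball2 (n + 1)}} \<inter> Kpl s n"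
    by (auto simp: piece_def Kpl_carrier)
  moreover have "openin G0_topology {g \<in> carrier G0. upper s g \<in> {z. z - x \<in> ball2 (n + 1)}}"
    unfolding upper_def by (cases s; simp only: if_True if_False) (rule openin_entry[OF Q.openin_coset])+
  ultimately show ?thesis
    unfolding openin_subtopology by blast
qed

lemma integral_over_Kpl:
  assumes haar: "is_haar_measure G0 (subtopology G0_topology (Kpl s n)) \<mu>"
    and R: "Q.W.residue_reps R" and g: "g \<in> carrier G0"
    and h: "\<And>d g. d \<in> Kmeet s n \<Longrightarrow> g \<in> carrier G0 \<Longrightarrow> h (d \<otimes>\<^bsub>G0\<^esub> g) = h g"
  shows "(LINT k|\<mu>. h (k \<otimes>\<^bsub>G0\<^esub> g)) =
    of_real (enn2real (emeasure \<mu> (Kmeet s n))) *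
      (\<Sum>a\<in>R. (h (unip s (\<omega>2 powi n * a) \<otimes>\<^bsub>G0\<^esub> g) :: complex))"
proof (rule integral_constant_on_pieces[where A = "\<lambda>a. piece s n (\<omega>2 powi n * a)"])
  have top: "topspace (subtopology G0_topology (Kpl s n)) = Kpl s n"
    using Kpl_carrier by (auto simp: topspace_G0_topology)
  have space: "space \<mu> = Kpl s n"
    using haar unfolding is_haar_measure_def top by blast
  show "finite R"
    using R by (simp add: Q.W.residue_reps_def)
  have R0: "\<omega>2 powi n * a \<in> ball2 n" if "a \<in> R" for a
    using Q.W.residue_reps_subset[OF R that] by (simp add: \<omega>2_power_mult_ball)
  show "disjoint_family_on (\<lambda>a. piece s n (\<omega>2 powi n * a)) R"
    unfolding disjoint_family_on_def
  proof (intro ballI impI)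
    fix a b assume ab: "a \<in> R" "b \<in> R" "a \<noteq> b"
    show "piece s n (\<omega>2 powi n * a) \<inter> piece s n (\<omega>2 powi n * b) = {}"
    proof (rule ccontr)
      assume "piece s n (\<omega>2 powi n * a) \<inter> piece s n (\<omega>2 powi n * b) \<noteq> {}"
      then obtain k where "upper s k - \<omega>2 powi n * a \<in> ball2 (n + 1)"
        "upper s k - \<omega>2 powi n * b \<in> ball2 (n + 1)"
        by (auto simp: piece_def)
      from Q.W.v_ball_diff[OF this] have "\<omega>2 powi n * (b - a) \<in> ball2 (n + 1)"
        by (simp add: algebra_simps)
      then have "b - a \<in> ball2 1"
        by (simp add: \<omega>2_power_mult_ball)
      then have "Q.W.rep R b = a"
        by (rule Q.W.rep_eqI[OF R ab(1)])
      moreover have "Q.W.rep R b = b"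
        by (rule Q.W.rep_eqI[OF R ab(2)]) (simp add: Q.W.v_ball_0)
      ultimately show False
        using ab by simp
    qed
  qed
  have "k \<in> (\<Union>a\<in>R. piece s n (\<omega>2 powi n * a))" if k: "k \<in> Kpl s n" for k
  proof -
    obtain a b c d z where abcd: "k = (mat2 s a b c d, z)"
      using Kpl_exhaust[OF k] .
    have b: "b = \<omega>2 powi n * (b / \<omega>2 powi n)"
      using Q.root_nonzero by simp
    have "b \<in> ball2 n"
      using k by (simp add: abcd Kpl_iff)
    then have "b / \<omega>2 powi n \<in> ball2 0"
      by (subst (asm) b) (simp only: \<omega>2_power_mult_ball, simp)
    note r = Q.W.rep[OF R this]
    have "b - \<omega>2 powi n * Q.W.rep R (b / \<omega>2 powi n) =
        \<omega>2 powi n * (b / \<omega>2 powi n - Q.W.rep R (b / \<omega>2 powi n))"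
      using Q.root_nonzero by (simp add: right_diff_distrib)
    also have "\<dots> \<in> ball2 (n + 1)"
      using r(2) by (simp add: \<omega>2_power_mult_ball)
    finally show ?thesis
      using r(1) k by (auto simp: piece_def abcd upper_mat2)
  qed
  then show "space \<mu> = (\<Union>a\<in>R. piece s n (\<omega>2 powi n * a))"
    by (auto simp: space piece_def)
  \<comment> \<open>The piece at 0 is the subgroup itself, whence its measurability.\<close>
  have Kmeet_piece: "Kmeet s n = piece s n 0"
    using piece_eq_left_coset[OF Q.W.v_ball_0, of s n] by (simp add: unip_0 G0_left_one)
  have meas: "piece s n x \<in> sets \<mu>" for x
    using haar openin_piece by (auto simp: is_haar_measure_def intro: sigma_sets.Basic)
  then show "piece s n (\<omega>2 powi n * a) \<in> sets \<mu>" for a .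
  fix a assume a: "a \<in> R"
  have "unip s (\<omega>2 powi n * a) \<in> Kpl s n"
    by (rule unip_in_Kpl[OF R0[OF a]])
  then show "emeasure \<mu> (piece s n (\<omega>2 powi n * a)) = emeasure \<mu> (Kmeet s n)"
    unfolding piece_eq_left_coset[OF R0[OF a]]
    using haar meas[of 0] unfolding is_haar_measure_def top Kmeet_piece by blast
  fix k assume "k \<in> piece s n (\<omega>2 powi n * a)"
  then obtain d where "d \<in> Kmeet s n" "k = d \<otimes>\<^bsub>G0\<^esub> unip s (\<omega>2 powi n * a)"
    unfolding piece_eq_right_coset[OF R0[OF a]] by blast
  then show "h (k \<otimes>\<^bsub>G0\<^esub> g) = h (unip s (\<omega>2 powi n * a) \<otimes>\<^bsub>G0\<^esub> g)"
    using h G0_closed[OF unip_in_G0 g] by (simp add: G0_assoc)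
qed


section \<open>Relevance of walls\<close>

text \<open>The variables \<open>a\<close> and \<open>b\<close> come from the inner and the outer
  integral. Factoring each product with elements of the group fixing \<open>f\<close> and of the
  torus on the left produces exactly the two cases of \<open>twisted_residue_sum\<close>.\<close>

lemma unipotent_double_sum:
  fixes f :: "('e2^2^2) \<times> 'e4 \<Rightarrow> complex"
  assumes R: "Q.W.residue_reps R" and g: "g \<in> carrier G0"
    and f_inv: "\<And>k g. k \<in> Kpl s (n + 1) \<Longrightarrow> g \<in> carrier G0 \<Longrightarrow> f (k \<otimes>\<^bsub>G0\<^esub> g) = f g"
    and f_tor: "\<And>t g. t \<noteq> 0 \<Longrightarrow> Q.w t = 0 \<Longrightarrow> g \<in> carrier G0 \<Longrightarrow> f (tor s t \<otimes>\<^bsub>G0\<^esub> g) = \<theta> t * f g"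
    and \<theta>_mult: "\<And>x y. x \<noteq> 0 \<Longrightarrow> y \<noteq> 0 \<Longrightarrow> \<theta> (x * y) = \<theta> x * \<theta> y"
    and \<theta>_one: "\<And>x. x \<in> ball2 1 \<Longrightarrow> \<theta> (1 + x) = 1"
    and nontrivial: "u \<noteq> 0" "Q.w u = 0" "\<theta> u \<noteq> 1"
  shows "(\<Sum>b\<in>R. \<Sum>a\<in>R. f (unip s (\<omega>2 powi n * a) \<otimes>\<^bsub>G0\<^esub> (unip (\<not> s) (\<omega>2 powi - n * b) \<otimes>\<^bsub>G0\<^esub> g)))
    = of_nat (card R) * f g"
proof -
  \<comment> \<open>Scaling opposite entries by inverse powers of the uniformiser makes the matrix
    identities the same for every wall.\<close>
  define V W where "V = \<omega>2 powi - n" and "W = \<omega>2 powi n"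
  have WV: "W * V = 1" "V * W = 1"
    using Q.root_nonzero by (simp_all add: V_def W_def power_int_minus)
  have W_ball: "W * y \<in> ball2 m \<longleftrightarrow> y \<in> ball2 (m - n)" and V_ball: "V * y \<in> ball2 m \<longleftrightarrow> y \<in> ball2 (m + n)" for y m
    using \<omega>2_power_mult_ball[of n y m] \<omega>2_power_mult_ball[of "- n" y m] by (simp_all add: V_def W_def)
  \<comment> \<open>The antidiagonal matrix represents the reflection in the wall.\<close>
  define \<kappa> where "\<kappa> = f ((mat2 s 0 W (- V) 0, 1) \<otimes>\<^bsub>G0\<^esub> g)"
  define \<psi> where "\<psi> x = f (unip s (W * x) \<otimes>\<^bsub>G0\<^esub> g)" for x
  have "(\<Sum>b\<in>R. \<Sum>a\<in>R. f (unip s (W * a) \<otimes>\<^bsub>G0\<^esub> (unip (\<not> s) (V * b) \<otimes>\<^bsub>G0\<^esub> g)))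
    = of_nat (card R) * \<psi> 0"
  proof (rule Q.W.twisted_residue_sum[OF R \<theta>_mult \<theta>_one nontrivial])
    show "Q.W.residue_function \<psi>"
      unfolding Q.W.residue_function_def
    proof (intro ballI)
      fix x y assume "x \<in> ball2 0" "y \<in> ball2 1"
      then have k: "unip s (W * y) \<in> Kpl s (n + 1)"
        by (intro unip_in_Kpl) (simp add: W_ball)
      have "unip s (W * (x + y)) = unip s (W * y) \<otimes>\<^bsub>G0\<^esub> unip s (W * x)"
        by (simp add: unip_add algebra_simps)
      then show "\<psi> (x + y) = \<psi> x"
        using f_inv[OF k G0_closed[OF unip_in_G0 g]] by (simp add: \<psi>_def G0_assoc)
    qed
  next
    fix a b assume a: "a \<in> ball2 0" and b: "b \<in> ball2 0" and "1 + a * b \<notin> ball2 1"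
    define t where "t = 1 + a * b"
    have "a * b \<in> ball2 0"
      using a b by (rule Q.W.v_ball_mult_unit)
    then have "t \<in> ball2 0"
      unfolding t_def by (intro Q.W.v_ball_add Q.W.v_ball_1)
    then have t: "t \<noteq> 0" "Q.w t = 0"
      using Q.W.v_unit_iff[of t] \<open>1 + a * b \<notin> ball2 1\<close> by (auto simp: t_def)
    have "b / t \<in> ball2 0"
      using b t by (cases "b = 0") (auto simp: Q.W.v_ball_def Q.W.v_divide)
    \<comment> \<open>The lower unipotent factor will be absorbed by \<open>f\<close>: interchanging
      the basis vectors turns \<open>Kpl (\<not> s) (- n)\<close> into
      \<open>Kpl s (n + 1)\<close>.\<close>
    then have "unip (\<not> s) (V * (b / t)) \<in> Kpl (\<not> s) (- n)"
      unfolding V_def by (intro unip_in_Kpl) (simp only: \<omega>2_power_mult_ball, simp)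
    then have k: "unip (\<not> s) (V * (b / t)) \<in> Kpl s (n + 1)"
      by (simp add: Kpl_swap add.commute)
    have "W * a * (V * b) = (W * V) * (a * b)" "V * b * (W * a) = (V * W) * (a * b)"
      by (simp_all only: mult_ac)
    then have cancel: "W * a * (V * b) = a * b" "V * b * (W * a) = a * b"
      by (simp_all add: WV)
    have "a * b / t + inverse t = (1 + a * b) / t"
      by (simp add: divide_inverse distrib_right add.commute)
    then have "a * b / t + inverse t = 1" "1 + a * b = t"
      using t by (simp_all flip: t_def)
    then have "unip s (W * a) \<otimes>\<^bsub>G0\<^esub> unip (\<not> s) (V * b) =
        unip (\<not> s) (V * (b / t)) \<otimes>\<^bsub>G0\<^esub> (tor s t \<otimes>\<^bsub>G0\<^esub> unip s (W * (a / t)))"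
      using t by (simp add: unip_def mat2_swap tor_def G0_mult mat2_mult mat2_eq_iff cancel)
    then have "f (unip s (W * a) \<otimes>\<^bsub>G0\<^esub> (unip (\<not> s) (V * b) \<otimes>\<^bsub>G0\<^esub> g)) =
        f (unip (\<not> s) (V * (b / t)) \<otimes>\<^bsub>G0\<^esub> (tor s t \<otimes>\<^bsub>G0\<^esub> (unip s (W * (a / t)) \<otimes>\<^bsub>G0\<^esub> g)))"
      by (simp flip: G0_assoc)
    also have "\<dots> = f (tor s t \<otimes>\<^bsub>G0\<^esub> (unip s (W * (a / t)) \<otimes>\<^bsub>G0\<^esub> g))"
    proof (rule f_inv[OF k G0_closed[OF _ G0_closed[OF unip_in_G0 g]]])
      show "tor s t \<in> carrier G0"
        using t by (simp add: tor_def SL2_in_G0 det_mat2)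
    qed
    also have "\<dots> = \<theta> t * \<psi> (a / t)"
      using f_tor[OF t G0_closed[OF unip_in_G0 g]] by (simp add: \<psi>_def)
    finally show "f (unip s (W * a) \<otimes>\<^bsub>G0\<^esub> (unip (\<not> s) (V * b) \<otimes>\<^bsub>G0\<^esub> g)) =
        \<theta> (1 + a * b) * \<psi> (a / (1 + a * b))"
      by (simp add: t_def)
  next
    fix a b assume a: "a \<in> ball2 0" and b: "b \<in> ball2 0" and ab: "1 + a * b \<in> ball2 1"
    have "a \<notin> ball2 1"
    proof
      assume "a \<in> ball2 1"
      then have "a * b \<in> ball2 1"
        using b by (rule Q.W.v_ball_mult_unit)
      from Q.W.v_ball_diff[OF ab this] show False
        by (simp add: Q.W.v_ball_def Q.W.v_one)
    qed
    then have a0: "a \<noteq> 0" "Q.w a = 0"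
      using Q.W.v_unit_iff[OF a] by auto
    \<comment> \<open>Obtained by dividing the product by the torus element on the left and by the
      reflection on the right. It lies in the group fixing \<open>f\<close> because
      \<open>1 + a * b\<close> is in the prime ideal.\<close>
    let ?k = "(mat2 s 1 (- (W * ((1 + a * b) / a))) (V * a) (- (a * b)), 1)"
    have "(1 + a * b) / a \<in> ball2 1"
      using ab a0 by (cases "1 + a * b = 0") (auto simp: Q.W.v_ball_def Q.W.v_divide)
    then have "- (W * ((1 + a * b) / a)) \<in> ball2 (n + 1)"
      by (intro Q.W.v_ball_uminus) (simp only: W_ball, simp)
    moreover have "V * a \<in> ball2 (1 - (n + 1))"
      using a by (simp only: V_ball) simp
    moreover have "- (a * b) - 1 \<in> ball2 1"
    proof -
      have "- (a * b) - 1 = - (1 + a * b)"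
        by simp
      then show ?thesis
        using Q.W.v_ball_uminus[OF ab] by (simp only:)
    qed
    moreover have det: "W * ((1 + a * b) / a) * (V * a) = 1 + a * b"
    proof -
      have "W * ((1 + a * b) / a) * (V * a) = (W * V) * ((1 + a * b) / a * a)"
        by (simp only: mult_ac)
      then show ?thesis
        using a0 by (simp add: WV)
    qed
    ultimately have k: "?k \<in> Kpl s (n + 1)"
      unfolding Kpl_iff using one_minus_one_p4 by (simp add: SL2_in_G0 det_mat2 Q.W.v_ball_0)
    have "W * a * (V * b) = (W * V) * (a * b)" "W * (1 + a * b) * V = (W * V) * (1 + a * b)"
      "V * a * W = (V * W) * a"
      by (simp_all only: mult_ac)
    then have cancel: "W * a * (V * b) = a * b" "W * (1 + a * b) * V = 1 + a * b" "V * a * W = a"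
      by (simp_all add: WV)
    have "unip s (W * a) \<otimes>\<^bsub>G0\<^esub> unip (\<not> s) (V * b) =
        tor s a \<otimes>\<^bsub>G0\<^esub> (?k \<otimes>\<^bsub>G0\<^esub> (mat2 s 0 W (- V) 0, 1))"
      using a0 by (simp add: unip_def mat2_swap tor_def G0_mult mat2_mult mat2_eq_iff cancel)
    then have "f (unip s (W * a) \<otimes>\<^bsub>G0\<^esub> (unip (\<not> s) (V * b) \<otimes>\<^bsub>G0\<^esub> g)) =
        f (tor s a \<otimes>\<^bsub>G0\<^esub> (?k \<otimes>\<^bsub>G0\<^esub> ((mat2 s 0 W (- V) 0, 1) \<otimes>\<^bsub>G0\<^esub> g)))"
      by (simp flip: G0_assoc)
    moreover have "(mat2 s 0 W (- V) 0, 1) \<otimes>\<^bsub>G0\<^esub> g \<in> carrier G0"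
      using g by (intro G0_closed SL2_in_G0) (simp_all add: det_mat2 WV)
    ultimately show "f (unip s (W * a) \<otimes>\<^bsub>G0\<^esub> (unip (\<not> s) (V * b) \<otimes>\<^bsub>G0\<^esub> g)) = \<theta> a * \<kappa>"
      using f_tor[OF a0 G0_closed[OF Kpl_carrier[OF k]]] f_inv[OF k] by (simp add: \<kappa>_def)
  qed
  then show ?thesis
    by (simp add: \<psi>_def unip_0 G0_left_one V_def W_def)
qed

section \<open>The norm character on the coroot torus\<close>

lemma Norm_nonzero: "x \<noteq> 0 \<Longrightarrow> E2.Norm x \<noteq> 0"
  using E2.Norm_mult[of x "inverse x"] E2.Norm_one by auto

lemma \<eta>_Norm_mult: "x \<noteq> 0 \<Longrightarrow> y \<noteq> 0 \<Longrightarrow> \<eta> (E2.Norm (x * y)) = \<eta> (E2.Norm x) * \<eta> (E2.Norm y)"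
  by (simp add: E2.Norm_mult Norm_nonzero \<eta>_character)

lemma \<eta>_Norm_principal: "x \<in> ball2 1 \<Longrightarrow> \<eta> (E2.Norm (1 + x)) = 1"
  using \<eta>_principal_units[OF Q.Norm_principal_unit[of x]] by (simp add: Q.p_E_eq)

lemma \<eta>_Norm_one: "\<eta> (E2.Norm 1) = 1"
  using \<eta>_Norm_principal[of 0] by (simp add: Q.W.v_ball_0)

lemma \<eta>_Norm_inverse: "x \<noteq> 0 \<Longrightarrow> \<eta> (E2.Norm (inverse x)) = inverse (\<eta> (E2.Norm x))"
  using \<eta>_Norm_mult[of x "inverse x"] by (simp add: \<eta>_Norm_one inverse_unique)

text \<open>The inverse appears because \<open>\<rho>_M0\<close> reads the second diagonal entry,
  where \<open>tor True t\<close> has \<open>inverse t\<close>.\<close>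

definition \<theta>_tor :: "bool \<Rightarrow> 'e2 \<Rightarrow> complex" where
  "\<theta>_tor s t = \<eta> (E2.Norm (if s then inverse t else t))"

lemma \<rho>_M0_tor: "\<rho>_M0 (tor s t) = \<theta>_tor s t"
  by (simp add: \<rho>_M0_def tor_def mat2_nth \<theta>_tor_def)

lemma \<theta>_tor_mult: "x \<noteq> 0 \<Longrightarrow> y \<noteq> 0 \<Longrightarrow> \<theta>_tor s (x * y) = \<theta>_tor s x * \<theta>_tor s y"
  by (simp add: \<theta>_tor_def \<eta>_Norm_mult)

lemma \<theta>_tor_principal: "x \<in> ball2 1 \<Longrightarrow> \<theta>_tor s (1 + x) = 1"
  using Q.W.v_ball_one_add(1)[of x] by (simp add: \<theta>_tor_def \<eta>_Norm_inverse \<eta>_Norm_principal)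

text \<open>Makes the truncated difference \<open>q_F - 1\<close> positive, so that the equation for
  \<open>\<zeta>\<close> forces it to be a unit.\<close>

lemma q_F_ge_2: "2 \<le> E2.q_F"
proof -
  interpret res: ring E2.res_field by (rule E2.res_field_ring)
  have "\<zero>\<^bsub>E2.res_field\<^esub> = E2.p_F"
    by (simp add: E2.res_field_def FactRing_def)
  moreover have "1 \<in> \<one>\<^bsub>E2.res_field\<^esub>" "1 \<notin> E2.p_F"
    by (simp_all add: E2.res_field_one E2.p_F_def E2.v_one)
  ultimately have "\<zero>\<^bsub>E2.res_field\<^esub> \<noteq> \<one>\<^bsub>E2.res_field\<^esub>"
    by metis
  then have "card {\<zero>\<^bsub>E2.res_field\<^esub>, \<one>\<^bsub>E2.res_field\<^esub>} = 2"
    by simp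
  then show ?thesis
    using card_mono[OF E2.finite_residue_field, of "{\<zero>\<^bsub>E2.res_field\<^esub>, \<one>\<^bsub>E2.res_field\<^esub>}"]
    by (simp add: E2.q_F_def)
qed

lemma \<zeta>_unit: "\<zeta> \<noteq> 0" "v \<zeta> = 0"
proof -
  have q: "E2.q_F - 1 \<noteq> 0"
    using q_F_ge_2 by simp
  then show "\<zeta> \<noteq> 0"
    using root_of_unity by (auto simp: power_0_left)
  then show "v \<zeta> = 0"
    using q root_of_unity E2.v_power[of \<zeta> "E2.q_F - 1"] by (simp add: E2.v_one)
qed

text \<open>The norm of \<open>\<zeta>\<close> is its square, so \<open>\<rho>_M0\<close> restricts to the quadratic character
  on the units of the coroot torus.\<close>

lemma \<theta>_tor_\<zeta>: "\<theta>_tor s (\<iota>2 \<zeta>) = - 1"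
proof -
  have nz: "\<iota>2 \<zeta> \<noteq> 0"
    using \<zeta>_unit by (simp add: E2.emb_eq_0_iff)
  have "\<eta> (E2.Norm (\<iota>2 \<zeta>)) = im ^ 2"
    using \<zeta>_unit by (simp add: Q.Norm_emb power2_eq_square \<eta>_character \<eta>_root_of_unity)
  then show ?thesis
    using nz im by (simp add: \<theta>_tor_def \<eta>_Norm_inverse)
qed

text \<open>Determinant 1 and second component 1 make the parahoric condition read 1 = 1, so the
  coroot torus lies in both groups.\<close>

lemma tor_in_K_M0:
  assumes K: "K = K_st \<or> K = K_par" and t: "t \<noteq> 0" "Q.w t = 0"
  shows "tor s t \<in> K_M0 K"
proof -
  have det: "Determinants.det (mat2 s t 0 0 (inverse t)) = 1"
    using t by (simp add: det_mat2)
  have G: "tor s t \<in> carrier G0"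
    using det by (simp add: tor_def SL2_in_G0)
  have E4: "1 \<in> E4.O_E_units"
    using E4.emb_O_E_iff[of 1] by (auto simp: E4.O_E_units_def E4.emb_one E2.O_F_def E2.v_one)
  have st: "tor s t \<in> K_st"
    using G t det E4 unfolding K_st_def I2_def tor_def
    by (simp add: mat2_nth Q.O_E_units_eq Q.O_E_eq Q.p_E_eq Q.W.v_ball_0 Q.W.v_inverse)
  interpret res: ring E2.res_field by (rule E2.res_field_ring)
  have "tor s t \<in> K_par"
    using st unfolding K_par_def tor_def by (simp add: det E2.red_one E4.red_one)
  moreover have "tor s t \<in> M0"
  proof -
    have "mat2 s t 0 0 (inverse t) = diag2 (if s then t else inverse t) (if s then inverse t else t)"
      by (simp add: mat2_def diag2_def)
    then show ?thesis
      using G unfolding M0_def tor_def by blast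
  qed
  ultimately show ?thesis
    using K st by (auto simp: K_M0_def)
qed

section \<open>Equivariant functions and composites of the operators\<close>

lemma one_in_K_M0: "K = K_st \<or> K = K_par \<Longrightarrow> (mat 1, 1) \<in> K_M0 K"
  using tor_in_K_M0[of K 1 True] by (simp add: tor_def mat2_one Q.W.v_one)

lemma one_in_K_plus: "(mat 1, 1) \<in> K_plus i"
  using unip_in_Kpl[OF Q.W.v_ball_0] by (simp add: K_plus_eq_Kpl unip_0)

text \<open>The definite description is well defined: the lower right entry of the product is the
  torus entry times a principal unit, on which the norm character is trivial, so this entry
  determines the value.\<close>

lemma \<rho>_ch_mult:
  assumes m: "m \<in> K_M0 K" and u: "u \<in> K_plus i"
  shows "\<rho>_ch K i (m \<otimes>\<^bsub>G0\<^esub> u) = \<rho>_M0 m"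
  unfolding \<rho>_ch_def
proof (rule the_equality)
  fix c assume "\<exists>m'\<in>K_M0 K. \<exists>u'\<in>K_plus i. m \<otimes>\<^bsub>G0\<^esub> u = m' \<otimes>\<^bsub>G0\<^esub> u' \<and> c = \<rho>_M0 m'"
  then obtain m' u' where m': "m' \<in> K_M0 K" and u': "u' \<in> K_plus i"
    and eq: "m \<otimes>\<^bsub>G0\<^esub> u = m' \<otimes>\<^bsub>G0\<^esub> u'" and c: "c = \<rho>_M0 m'"
    by blast
  have *: "\<eta> (E2.Norm (fst (m \<otimes>\<^bsub>G0\<^esub> u) $ 2 $ 2)) = \<rho>_M0 m" if mK: "m \<in> K_M0 K" and uK: "u \<in> K_plus i" for m u
  proof -
    obtain x y z where "m = (diag2 x y, z)" and mG: "m \<in> carrier G0"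
      using mK unfolding K_M0_def M0_def by blast
    then have m: "m = (mat2 True x 0 0 y, z)"
      by (simp add: diag2_def mat2_def)
    obtain a b c d w where u: "u = (mat2 True a b c d, w)"
      using Kpl_exhaust uK unfolding K_plus_eq_Kpl by metis
    have d: "d - 1 \<in> ball2 1"
      using uK unfolding K_plus_eq_Kpl u Kpl_iff by simp
    have "y \<noteq> 0"
      using mG by (auto simp: m G0_carrier_iff det_mat2)
    moreover have "d \<noteq> 0" "\<eta> (E2.Norm d) = 1"
      using Q.W.v_ball_one_add(1)[OF d] \<eta>_Norm_principal[OF d] by auto
    ultimately show ?thesis
      by (simp add: m u G0_mult mat2_mult mat2_nth \<rho>_M0_def \<eta>_Norm_mult)
  qed
  show "c = \<rho>_M0 m"
    using *[OF m u] *[OF m' u'] by (simp add: c eq)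
qed (use assms in blast)

lemma ind_equivariant:
  assumes f: "f \<in> ind K i" and m: "m \<in> K_M0 K" and u: "u \<in> K_plus i" and g: "g \<in> carrier G0"
  shows "f ((m \<otimes>\<^bsub>G0\<^esub> u) \<otimes>\<^bsub>G0\<^esub> g) = \<rho>_M0 m * f g"
proof -
  have "m \<otimes>\<^bsub>G0\<^esub> u \<in> K_ch K i"
    using m u unfolding K_ch_def set_mult_def by blast
  then show ?thesis
    using f g \<rho>_ch_mult[OF m u] unfolding ind_def by simp
qed

text \<open>The parameter \<open>s\<close> covers both orders of crossing a wall: either adjacent
  chamber can be written as \<open>Kpl s (n + 1)\<close> with the other one as
  \<open>Kpl s n\<close>.\<close>

lemma Theta_composition:
  assumes K: "K = K_st \<or> K = K_par" and f: "f \<in> ind K i"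
    and Ki: "K_plus i = Kpl s (n + 1)" and Kj: "K_plus j = Kpl s n"
    and haar: "\<And>j. is_haar_measure G0 (subtopology G0_topology (K_plus j)) (\<mu> j)"
    and R: "Q.W.residue_reps R"
  shows "Theta \<mu> i (Theta \<mu> j f) = (\<lambda>g. of_real (enn2real (emeasure (\<mu> i) (Kmeet s n))) *
    of_real (enn2real (emeasure (\<mu> j) (Kmeet s n))) * of_nat (card R) * f g)"
proof
  fix g
  define c d where "c = complex_of_real (enn2real (emeasure (\<mu> i) (Kmeet s n)))"
    and "d = complex_of_real (enn2real (emeasure (\<mu> j) (Kmeet s n)))"
  have "\<rho>_M0 (mat 1, 1) = 1"
    by (simp add: \<rho>_M0_def mat_def \<eta>_Norm_one)
  then have f_inv: "f (k \<otimes>\<^bsub>G0\<^esub> g) = f g" if "k \<in> Kpl s (n + 1)" "g \<in> carrier G0" for k g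
    using ind_equivariant[OF f one_in_K_M0[OF K], of k g] that
    by (simp add: Ki G0_left_one)
  have f_tor: "f (tor s t \<otimes>\<^bsub>G0\<^esub> g) = \<theta>_tor s t * f g"
    if "t \<noteq> 0" "Q.w t = 0" "g \<in> carrier G0" for t g
    using ind_equivariant[OF f tor_in_K_M0[OF K that(1,2)] one_in_K_plus that(3)]
    by (simp add: G0_right_one \<rho>_M0_tor)
  have inner_sum: "Theta \<mu> j f g = d * (\<Sum>a\<in>R. f (unip s (\<omega>2 powi n * a) \<otimes>\<^bsub>G0\<^esub> g))"
    if "g \<in> carrier G0" for g
    using integral_over_Kpl[OF haar[of j, unfolded Kj] R that, of f] f_inv that
    by (simp add: Theta_def d_def Kmeet_def)
  \<comment> \<open>The outer integral is cut along the same intersection, so invariance under it is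
    what must be checked. \<open>unip s x\<close> moves past it because left and right cosets agree,
    and \<open>f\<close> then absorbs the intersection.\<close>
  have F_inv: "Theta \<mu> j f (k \<otimes>\<^bsub>G0\<^esub> g) = Theta \<mu> j f g"
    if k: "k \<in> Kmeet (\<not> s) (- n)" and g: "g \<in> carrier G0" for k g
  proof -
    have k': "k \<in> Kmeet s n"
      using k by (simp add: Kmeet_swap)
    have kG: "k \<in> carrier G0"
      using k' Kpl_carrier[of k s n] by (simp add: Kmeet_def)
    have "f (unip s x \<otimes>\<^bsub>G0\<^esub> (k \<otimes>\<^bsub>G0\<^esub> g)) = f (unip s x \<otimes>\<^bsub>G0\<^esub> g)" if x: "x \<in> ball2 n" for x
    proof -
      have "unip s x \<otimes>\<^bsub>G0\<^esub> k \<in> (\<lambda>d. d \<otimes>\<^bsub>G0\<^esub> unip s x) ` Kmeet s n"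
        using k' piece_eq_left_coset[OF x, of s] piece_eq_right_coset[OF x, of s] by blast
      then obtain e where e: "e \<in> Kmeet s n" "unip s x \<otimes>\<^bsub>G0\<^esub> k = e \<otimes>\<^bsub>G0\<^esub> unip s x"
        by blast
      then show ?thesis
        using f_inv[of e "unip s x \<otimes>\<^bsub>G0\<^esub> g"] G0_closed[OF unip_in_G0 g]
        by (simp add: Kmeet_def flip: G0_assoc)
    qed
    moreover have "\<omega>2 powi n * a \<in> ball2 n" if "a \<in> R" for a
      using Q.W.residue_reps_subset[OF R that] by (simp add: \<omega>2_power_mult_ball)
    ultimately show ?thesis
      by (simp add: inner_sum g G0_closed[OF kG g])
  qed
  \<comment> \<open>In the interchanged basis the outer integral runs over the opposite unipotents,
    as the double sum requires.\<close>
  have Ki': "K_plus i = Kpl (\<not> s) (- n)"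
    by (simp add: Ki Kpl_swap add.commute)
  have Kmeet: "Kmeet (\<not> s) (- n) = Kmeet s n"
    by (rule Kmeet_swap)
  show "Theta \<mu> i (Theta \<mu> j f) g = c * d * of_nat (card R) * f g"
  proof (cases "g \<in> carrier G0")
    case True
    have "Theta \<mu> i (Theta \<mu> j f) g =
        c * (\<Sum>b\<in>R. Theta \<mu> j f (unip (\<not> s) (\<omega>2 powi - n * b) \<otimes>\<^bsub>G0\<^esub> g))"
      using integral_over_Kpl[OF haar[of i, unfolded Ki'] R True F_inv] True
      by (simp add: Theta_def[of \<mu> i] c_def Kmeet)
    also have "\<dots> = c * d * (\<Sum>b\<in>R. \<Sum>a\<in>R.
        f (unip s (\<omega>2 powi n * a) \<otimes>\<^bsub>G0\<^esub> (unip (\<not> s) (\<omega>2 powi - n * b) \<otimes>\<^bsub>G0\<^esub> g)))"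
      by (simp add: inner_sum G0_closed[OF unip_in_G0 True] sum_distrib_left mult.assoc)
    \<comment> \<open>The unit \<open>\<zeta>\<close> witnesses nontriviality: the character takes
      the value -1 there for both \<open>s\<close>.\<close>
    also have "\<dots> = c * d * (of_nat (card R) * f g)"
      using \<zeta>_unit by (subst unipotent_double_sum[OF R True f_inv f_tor \<theta>_tor_mult \<theta>_tor_principal,
            where u = "\<iota>2 \<zeta>"]) (simp_all add: E2.emb_eq_0_iff Q.w_emb \<theta>_tor_\<zeta>)
    finally show ?thesis
      by (simp add: mult.assoc)
  next
    case False
    then have "f g = 0"
      using f unfolding ind_def by blast
    then show ?thesis
      using False by (simp add: Theta_def[of \<mu> i])
  qed
qed

lemma no_relevant_wall:
  assumes K: "K = K_st \<or> K = K_par"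
    and haar: "\<And>j. is_haar_measure G0 (subtopology G0_topology (K_plus j)) (\<mu> j)"
  shows "\<not> relevant_wall K \<mu> i"
proof -
  obtain R where R: "Q.W.residue_reps R"
    using Q.residue_reps_exist by blast
  have "K_plus i = Kpl True (- i - 1 + 1)" "K_plus (i + 1) = Kpl True (- i - 1)"
    by (simp_all add: K_plus_eq_Kpl)
  from Theta_composition[OF K _ this haar R]
  have "\<exists>c. \<forall>f\<in>ind K i. Theta \<mu> i (Theta \<mu> (i + 1) f) = (\<lambda>g. c * f g)"
    by blast
  \<comment> \<open>The opposite composite starts from chamber \<open>i + 1\<close>; with the basis
    vectors interchanged it has the same shape.\<close>
  moreover have "K_plus (i + 1) = Kpl False (i + 1 + 1)" "K_plus i = Kpl False (i + 1)"
    using Kpl_swap[of True "i + 1 + 1"] Kpl_swap[of True "i + 1"] by (simp_all add: K_plus_eq_Kpl algebra_simps)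
  from Theta_composition[OF K _ this haar R]
  have "\<exists>c. \<forall>f\<in>ind K (i + 1). Theta \<mu> (i + 1) (Theta \<mu> i f) = (\<lambda>g. c * f g)"
    by blast
  ultimately show ?thesis
    by (simp add: relevant_wall_def)
qed

end

theorem proposition3p8:
  fixes v :: "'f::field \<Rightarrow> int"
    and \<iota>2 :: "'f \<Rightarrow> 'e2::field" and b2 :: "2 \<Rightarrow> 'e2"
    and \<iota>4 :: "'f \<Rightarrow> 'e4::field" and b4 :: "4 \<Rightarrow> 'e4"
    and p :: nat and \<pi>_F \<zeta> :: 'f and im :: complex and \<eta> :: "'f \<Rightarrow> complex"
    and K0 :: "(('e2^2^2) \<times> 'e4) set" and \<mu> :: "int \<Rightarrow> (('e2^2^2) \<times> 'e4) measure"
  assumes setting: "counterexample_setting v \<iota>2 b2 \<iota>4 b4 p \<pi>_F \<zeta> im \<eta>"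
    and K0: "K0 = counterexample_setting.K_st v \<iota>2 b2 \<iota>4 b4 \<or>
             K0 = counterexample_setting.K_par v \<iota>2 b2 \<iota>4 b4"
    and haar: "\<And>j. is_haar_measure
      (counterexample_setting.G0 \<iota>2 b2 \<iota>4 b4)
      (subtopology (counterexample_setting.G0_topology v \<iota>2 b2 \<iota>4 b4)
        (counterexample_setting.K_plus v \<iota>2 b2 \<iota>4 b4 j))
      (\<mu> j)"
  shows "carrier (counterexample_setting.W_rho \<iota>2 b2 \<iota>4 b4 \<eta> K0) =
         counterexample_setting.Omega_rho v \<iota>2 b2 \<iota>4 b4 \<eta> K0 \<mu>"
proof -
  interpret counterexample_setting v \<iota>2 b2 \<iota>4 b4 p \<pi>_F \<zeta> im \<eta>
    by (rule setting)
  \<comment> \<open>The set being counted is empty, wherever \<open>w\<close> moves chamber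
    0.\<close>
  have "length_rel K0 \<mu> w = 0" for w
    using no_relevant_wall[OF K0 haar] by (simp add: length_rel_def)
  then show ?thesis
    by (simp add: Omega_rho_def)
qed

end
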